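(* Let $\beta<0$, let $u_0\in\mathcal{L}(1)$, and let $u$ be the solution of the $\beta$-Szegő equation $$i\partial_t u=\Pi(|u|^2u)-\beta\,S\,\Pi\big(|S^\dagger u|^2S^\dagger u\big)$$ with $u(0)=u_0$. Then all Sobolev norms of $u$ remain bounded: for every $s\ge0$ there is a constant $C>0$ (which may depend on $s$, $\beta$ and $u_0$) such that $$\|u(t)\|_{H^s}\le C\qquad\text{for all }t\in\mathbb{R}.$$
   Context: $L^2_+(\mathbb{S}^1)$ is the closed subspace of $L^2(\mathbb{S}^1)$ of functions $u=\sum_{n\ge 0}\alpha_ne^{in\theta}$; such $u$ is identified with $u(z)=\sum_{n\ge0}\alpha_nz^n$. $H^s_+(\mathbb{S}^1)=H^s(\mathbb{S}^1)\cap L^2_+(\mathbb{S}^1)$, with $\|u\|_{H^s}^2=\sum_{n\ge0}(1+n)^{2s}|\alpha_n|^2$. $\Pi:L^2(\mathbb{S}^1)\to L^2_+(\mathbb{S}^1)$ is the Szegő projector (removing negative Fourier modes). $S$ is the shift $Sh=e^{i\theta}h$ on $L^2_+$, and $S^\dagger$ is its adjoint, $(S^\dagger h)_n=h_{n+1}$. The equation is globally well-posed in $H^s_+(\mathbb{S}^1)$ for $s>1/2$. $\mathcal{L}(1)$ is the set of rational functions $u(z)=A(z)/B(z)$ where $A,B$ are complex polynomials of degree at most $1$ with no common factors, $\deg A=1$ or $\deg B=1$, and $B$ has no zeros in the closed unit disk. *)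

theory Defs
  imports "HOL-Analysis.Analysis" "HOL-Computational_Algebra.Polynomial"
begin

text \<open>
  An element of \<open>L\<^sup>2(S\<^sup>1)\<close> is given by a representative \<open>f :: complex \<Rightarrow> complex\<close>, of which only
  the values \<open>f (cis \<theta>)\<close> on the unit circle matter, up to a null set of angles.  Everything
  below is invariant under changing representatives, as it sees \<open>f\<close> through integrals only
  or is itself pointwise almost everywhere.
\<close>

abbreviation angles :: "real measure" where
  "angles \<equiv> lebesgue_on {0..2 * pi}"

definition L2_circle :: "(complex \<Rightarrow> complex) set" where
  "L2_circle = {f. (\<lambda>\<theta>. f (cis \<theta>)) \<in> borel_measurable angles \<and>
                   integrable angles (\<lambda>\<theta>. (cmod (f (cis \<theta>)))\<^sup>2)}"

definition fourier_coeff :: "(complex \<Rightarrow> complex) \<Rightarrow> int \<Rightarrow> complex" where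
  "fourier_coeff f n = (LINT \<theta>|angles. f (cis \<theta>) * cis (- (of_int n * \<theta>))) / of_real (2 * pi)"

definition L2_plus :: "(complex \<Rightarrow> complex) set" where
  "L2_plus = {f \<in> L2_circle. \<forall>n<0. fourier_coeff f n = 0}"

definition Hs_plus :: "real \<Rightarrow> (complex \<Rightarrow> complex) set" where
  "Hs_plus s = {f \<in> L2_plus.
     summable (\<lambda>n. (1 + real n) powr (2 * s) * (cmod (fourier_coeff f (int n)))\<^sup>2)}"

text \<open>Only meaningful on \<open>Hs_plus s\<close>; for \<open>s = 0\<close> it is the norm of \<open>L2_plus\<close>.\<close>

definition Hs_norm :: "real \<Rightarrow> (complex \<Rightarrow> complex) \<Rightarrow> real" where
  "Hs_norm s f =
     sqrt (\<Sum>n. (1 + real n) powr (2 * s) * (cmod (fourier_coeff f (int n)))\<^sup>2)"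

text \<open>
  The next two operators return the representative given by the pointwise sum of the Fourier
  series.  They are only applied to functions in \<open>H\<^sup>s(S\<^sup>1)\<close> with \<open>s > 1/2\<close>, where the series
  converges absolutely on the circle.
\<close>

definition szego_proj :: "(complex \<Rightarrow> complex) \<Rightarrow> complex \<Rightarrow> complex" where
  "szego_proj f z = (\<Sum>n. fourier_coeff f (int n) * z ^ n)"

definition adj_shift :: "(complex \<Rightarrow> complex) \<Rightarrow> complex \<Rightarrow> complex" where
  "adj_shift h z = (\<Sum>n. fourier_coeff h (int n + 1) * z ^ n)"

definition shift :: "(complex \<Rightarrow> complex) \<Rightarrow> complex \<Rightarrow> complex" where
  "shift h z = z * h z"

definition cubic :: "(complex \<Rightarrow> complex) \<Rightarrow> complex \<Rightarrow> complex" where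
  "cubic f z = of_real ((cmod (f z))\<^sup>2) * f z"

definition beta_szego_rhs :: "real \<Rightarrow> (complex \<Rightarrow> complex) \<Rightarrow> complex \<Rightarrow> complex" where
  "beta_szego_rhs \<beta> f z =
     szego_proj (cubic f) z - of_real \<beta> * shift (szego_proj (cubic (adj_shift f))) z"

definition has_L2_time_derivative ::
    "(real \<Rightarrow> complex \<Rightarrow> complex) \<Rightarrow> (complex \<Rightarrow> complex) \<Rightarrow> real \<Rightarrow> bool" where
  "has_L2_time_derivative u v t \<longleftrightarrow>
     ((\<lambda>h. Hs_norm 0 (\<lambda>z. (u (t + h) z - u t z) / of_real h - v z)) \<longlongrightarrow> 0) (at 0)"

text \<open>
  Global solutions in \<open>C(\<real>, H\<^sup>\<sigma>\<^sub>+)\<close>, the class in which the equation is well-posed for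
  \<open>\<sigma> > 1/2\<close>; the time derivative is that of an \<open>L\<^sup>2\<^sub>+\<close>-valued function.
\<close>

definition beta_szego_solution :: "real \<Rightarrow> real \<Rightarrow> (real \<Rightarrow> complex \<Rightarrow> complex) \<Rightarrow> bool" where
  "beta_szego_solution \<sigma> \<beta> u \<longleftrightarrow>
     (\<forall>t. u t \<in> Hs_plus \<sigma>) \<and>
     (\<forall>t. ((\<lambda>\<tau>. Hs_norm \<sigma> (\<lambda>z. u \<tau> z - u t z)) \<longlongrightarrow> 0) (at t)) \<and>
     (\<forall>t. has_L2_time_derivative (\<lambda>\<tau> z. \<i> * u \<tau> z) (beta_szego_rhs \<beta> (u t)) t)"

definition rational_L1 :: "(complex \<Rightarrow> complex) set" where
  "rational_L1 = {\<lambda>z. poly A z / poly B z | A B.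
     degree A \<le> 1 \<and> degree B \<le> 1 \<and> coprime A B \<and> (degree A = 1 \<or> degree B = 1) \<and>
     (\<forall>z. cmod z \<le> 1 \<longrightarrow> poly B z \<noteq> 0)}"

end

theory Submission
  imports Defs "HOL-Real_Asymp.Real_Asymp"
begin

text \<open>
  Let \<open>a\<^sub>n\<close> be the Fourier coefficients of the solution.  The derivative of each entry of the Hankel matrix
  \<open>K\<^sub>j\<^sub>l = a\<^sub>1\<^sub>+\<^sub>j\<^sub>+\<^sub>l\<close> of \<open>S\<^sup>\<dagger> u\<close> is a bounded linear functional of the column \<open>l\<close>, depending on \<open>j\<close> only, plus
  one of the row \<open>j\<close>, depending on \<open>l\<close> only (a Lax pair).  Hence both \<open>K\<close> and its 2 by 2 minors solve linear equations, and
  by uniqueness \<open>K\<close> keeps rank exactly one: \<open>u = b + c z / (1 - p z)\<close> for all times, with no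
  existence theory needed.

  With \<open>Y = 1 - |p|\<^sup>2\<close>, the quantities \<open>M = |c|\<^sup>2 / Y\<^sup>2\<close>, \<open>N = |b|\<^sup>2 + M Y\<close> and
  \<open>E = 2 N Y - 3 M Y\<^sup>2 + (1 - \<beta>) M (2 Y - Y\<^sup>2) + 4 Re (cnj b c cnj p)\<close> (from momentum, mass
  and energy) are constant.  The AM-GM inequality gives
  \<open>E \<ge> M Y (- 2 \<beta> - (2 - \<beta>) Y)\<close>, while \<open>E \<le> K Y\<close> for some constant \<open>K\<close>.  So for \<open>\<beta> < 0\<close>
  either \<open>E > 0\<close> and \<open>Y \<ge> E / K\<close>, or \<open>E \<le> 0\<close> and \<open>Y \<ge> - 2 \<beta> / (2 - \<beta>)\<close>: \<open>|p|\<close> stays away from 1.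
\<close>

section \<open>Fourier coefficients on the circle\<close>

text \<open>The solution is only a continuous curve in \<open>Hs_plus \<sigma>\<close> with an
  \<open>L2\<close> time derivative, and each \<open>u t\<close> is only a representative. Two
  obstacles follow. The term \<open>cubic (u t)\<close> reads point values, so before the equation
  can be written in coefficients, \<open>u t\<close> has to be identified almost everywhere with its
  Fourier series; this is what the uniqueness theorem for integrable functions on the circle is for.
  And the Hankel matrix is differentiated entry by entry only, so the Lax pair is not integrated
  through an evolution of operators. Instead, uniqueness is shown for infinite families of scalar
  functions whose derivatives are controlled by a common bound of the family, which needs no more
  than a local bound of the \<open>l^1\<close> norm of the coefficients. Vanishing minors give rank
  at most one; the same uniqueness applied to the entries themselves, from a later or earlier time
  back to time 0, excludes rank zero.\<close>

lemma integrable_bounded_mult: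
  fixes f h :: "'a \<Rightarrow> complex"
  assumes "integrable M f" "h \<in> borel_measurable M" "AE x in M. norm (h x) \<le> B"
  shows "integrable M (\<lambda>x. h x * f x)"
proof (rule Bochner_Integration.integrable_bound)
  show "integrable M (\<lambda>x. B * norm (f x))"
    using assms(1) by auto
  show "(\<lambda>x. h x * f x) \<in> borel_measurable M"
    using assms by auto
  show "AE x in M. norm (h x * f x) \<le> norm (B * norm (f x))"
    using assms(3)
  proof eventually_elim
    case (elim x)
    then have "0 \<le> B" by (meson norm_ge_zero order_trans)
    with elim show ?case by (simp add: norm_mult abs_mult mult_right_mono)
  qed
qed

definition circle_integrable :: "(complex \<Rightarrow> complex) \<Rightarrow> bool" where
  "circle_integrable f \<longleftrightarrow> integrable angles (\<lambda>\<theta>. f (cis \<theta>))"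

lemma measurable_angles_continuous:
  "continuous_on {0..2*pi} f \<Longrightarrow> f \<in> borel_measurable angles" for f :: "real \<Rightarrow> 'b::euclidean_space"
  by (simp add: continuous_imp_measurable_on_sets_lebesgue)

lemma circle_integrable_cis:
  assumes "circle_integrable f"
  shows "integrable angles (\<lambda>\<theta>. f (cis \<theta>) * cis (c * \<theta>))"
proof -
  have "integrable angles (\<lambda>\<theta>. cis (c * \<theta>) * f (cis \<theta>))"
    by (rule integrable_bounded_mult[where B = 1])
      (use assms in \<open>auto simp: circle_integrable_def intro!: measurable_angles_continuous continuous_intros\<close>)
  then show ?thesis by (simp add: mult.commute)
qed

lemma finite_measure_angles: "finite_measure angles"
  by (simp add: finite_measure_lebesgue_on)

lemma circle_integrable_const [simp]: "circle_integrable (\<lambda>z. c)"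
  unfolding circle_integrable_def
  by (intro finite_measure.integrable_const finite_measure_angles)

lemma circle_integrable_L2:
  assumes "f \<in> L2_circle"
  shows "circle_integrable f"
proof -
  have m: "(\<lambda>\<theta>. f (cis \<theta>)) \<in> borel_measurable angles"
    and i: "integrable angles (\<lambda>\<theta>. (cmod (f (cis \<theta>)))\<^sup>2)"
    using assms by (auto simp: L2_circle_def)
  show ?thesis
    unfolding circle_integrable_def
  proof (rule Bochner_Integration.integrable_bound[OF _ m])
    show "integrable angles (\<lambda>\<theta>. 1 + (cmod (f (cis \<theta>)))\<^sup>2)"
      using i by (intro Bochner_Integration.integrable_add finite_measure.integrable_const finite_measure_angles)
    have "x \<le> \<bar>1 + x\<^sup>2\<bar>" if "x \<ge> 0" for x :: real
      using zero_le_power2[of "x - 1"] that by (simp add: power2_diff)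
    then show "AE \<theta> in angles. norm (f (cis \<theta>)) \<le> norm (1 + (cmod (f (cis \<theta>)))\<^sup>2)"
      by (intro AE_I2) simp
  qed
qed

lemma fourier_coeff_add:
  "circle_integrable f \<Longrightarrow> circle_integrable g \<Longrightarrow>
   fourier_coeff (\<lambda>z. f z + g z) n = fourier_coeff f n + fourier_coeff g n"
  unfolding fourier_coeff_def
  using circle_integrable_cis[of f "- of_int n"] circle_integrable_cis[of g "- of_int n"]
  by (simp add: distrib_right add_divide_distrib)

lemma fourier_coeff_cmult: "fourier_coeff (\<lambda>z. c * f z) n = c * fourier_coeff f n"
  unfolding fourier_coeff_def by (simp add: mult.assoc)

lemma fourier_coeff_diff:
  "circle_integrable f \<Longrightarrow> circle_integrable g \<Longrightarrow>
   fourier_coeff (\<lambda>z. f z - g z) n = fourier_coeff f n - fourier_coeff g n"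
  unfolding fourier_coeff_def
  using circle_integrable_cis[of f "- of_int n"] circle_integrable_cis[of g "- of_int n"]
  by (simp add: left_diff_distrib diff_divide_distrib)

lemma circle_integrable_add [intro]:
  "circle_integrable f \<Longrightarrow> circle_integrable g \<Longrightarrow> circle_integrable (\<lambda>z. f z + g z)"
  and circle_integrable_diff [intro]:
  "circle_integrable f \<Longrightarrow> circle_integrable g \<Longrightarrow> circle_integrable (\<lambda>z. f z - g z)"
  and circle_integrable_cmult [intro]:
  "circle_integrable f \<Longrightarrow> circle_integrable (\<lambda>z. c * f z)"
  unfolding circle_integrable_def by auto

lemma fourier_coeff_cong_AE:
  assumes "AE \<theta> in angles. f (cis \<theta>) = g (cis \<theta>)"
    "(\<lambda>\<theta>. f (cis \<theta>)) \<in> borel_measurable angles" "(\<lambda>\<theta>. g (cis \<theta>)) \<in> borel_measurable angles"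
  shows "fourier_coeff f n = fourier_coeff g n"
proof -
  have [measurable]: "(\<lambda>\<theta>. cis (- (of_int n * \<theta>))) \<in> borel_measurable angles"
    by (intro measurable_angles_continuous continuous_intros)
  note assms(2,3)[measurable]
  have "(LINT \<theta>|angles. f (cis \<theta>) * cis (- (of_int n * \<theta>))) = (LINT \<theta>|angles. g (cis \<theta>) * cis (- (of_int n * \<theta>)))"
    using assms(1) by (intro integral_cong_AE) (auto, measurable)
  then show ?thesis by (simp add: fourier_coeff_def)
qed

lemma fourier_coeff_times_id: "fourier_coeff (\<lambda>z. z * f z) n = fourier_coeff f (n - 1)"
proof -
  have "cis \<theta> * f (cis \<theta>) * cis (- (of_int n * \<theta>)) = f (cis \<theta>) * cis (- (of_int (n - 1) * \<theta>))" for \<theta>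
  proof -
    have "cis \<theta> * cis (- (of_int n * \<theta>)) = cis (- (of_int (n - 1) * \<theta>))"
      unfolding cis_mult by (rule arg_cong[where f = cis]) (simp add: algebra_simps)
    then show ?thesis by (metis mult.assoc mult.commute)
  qed
  then show ?thesis by (simp only: fourier_coeff_def)
qed

lemma fourier_coeff_times_cnj: "fourier_coeff (\<lambda>z. cnj z * f z) n = fourier_coeff f (n + 1)"
proof -
  have "cnj (cis \<theta>) * f (cis \<theta>) * cis (- (of_int n * \<theta>)) = f (cis \<theta>) * cis (- (of_int (n + 1) * \<theta>))" for \<theta>
  proof -
    have "cnj (cis \<theta>) * cis (- (of_int n * \<theta>)) = cis (- (of_int (n + 1) * \<theta>))"
      unfolding cis_cnj cis_mult by (rule arg_cong[where f = cis]) (simp add: algebra_simps)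
    then show ?thesis by (metis mult.assoc mult.commute)
  qed
  then show ?thesis by (simp only: fourier_coeff_def)
qed

text \<open>Termwise integration, justified by the absolute summability of \<open>a\<close>. The
  frequencies \<open>s\<close> are free so that one lemma serves a power series
  (\<open>s = int\<close>) and its conjugate (\<open>s = - int\<close>); \<open>f\<close> need only
  be integrable, so products can be built one factor at a time.\<close>

lemma fourier_coeff_trig_series_mult:
  fixes a :: "nat \<Rightarrow> complex" and s :: "nat \<Rightarrow> int"
  assumes a: "summable (\<lambda>k. norm (a k))" and f: "circle_integrable f"
    and g: "\<And>\<theta>. g (cis \<theta>) = (\<Sum>k. a k * cis (of_int (s k) * \<theta>))"
  shows "circle_integrable (\<lambda>z. g z * f z)"
    and "(\<lambda>k. a k * fourier_coeff f (n - s k)) sums fourier_coeff (\<lambda>z. g z * f z) n"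
proof -
  let ?h = "\<lambda>n k \<theta>. a k * (f (cis \<theta>) * cis (- (of_int (n - s k) * \<theta>)))"
  have int: "integrable angles (?h n k)" for n k
    using circle_integrable_cis[OF f, of "- of_int (n - s k)"]
    by (intro integrable_mult_right) (simp only: mult_minus_left)
  have nrm: "norm (?h n k \<theta>) = norm (a k) * norm (f (cis \<theta>))" for n k \<theta>
    by (simp add: norm_mult)
  have s1: "AE \<theta> in angles. summable (\<lambda>k. norm (?h n k \<theta>))" for n
    unfolding nrm using a by (intro AE_I2 summable_mult2)
  have s2: "summable (\<lambda>k. LINT \<theta>|angles. norm (?h n k \<theta>))" for n
    unfolding nrm using a by (simp add: summable_mult2)
  have eq: "(\<Sum>k. ?h n k \<theta>) = g (cis \<theta>) * f (cis \<theta>) * cis (- (of_int n * \<theta>))" for n \<theta>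
  proof -
    have sm: "summable (\<lambda>k. a k * cis (of_int (s k) * \<theta>))"
      by (rule summable_norm_cancel) (use a in \<open>simp add: norm_mult\<close>)
    have "?h n k \<theta> = a k * cis (of_int (s k) * \<theta>) * (f (cis \<theta>) * cis (- (of_int n * \<theta>)))" for k
    proof -
      have "cis (- (of_int (n - s k) * \<theta>)) = cis (of_int (s k) * \<theta>) * cis (- (of_int n * \<theta>))"
        unfolding cis_mult by (rule arg_cong[where f = cis]) (simp add: algebra_simps)
      then show ?thesis by simp
    qed
    then have "(\<Sum>k. ?h n k \<theta>) = (\<Sum>k. a k * cis (of_int (s k) * \<theta>) * (f (cis \<theta>) * cis (- (of_int n * \<theta>))))"
      by (simp only:)
    also have "\<dots> = g (cis \<theta>) * (f (cis \<theta>) * cis (- (of_int n * \<theta>)))"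
      unfolding g by (rule suminf_mult2[symmetric, OF sm])
    finally show ?thesis by (simp add: mult.assoc)
  qed
  show "circle_integrable (\<lambda>z. g z * f z)"
    using integrable_suminf[OF int s1 s2, of 0] unfolding eq circle_integrable_def by simp
  have "(\<lambda>k. LINT \<theta>|angles. ?h n k \<theta>) sums (LINT \<theta>|angles. g (cis \<theta>) * f (cis \<theta>) * cis (- (of_int n * \<theta>)))"
    using sums_integral[OF int s1 s2, of n] unfolding eq .
  from sums_divide[OF this, of "of_real (2*pi)"]
  show "(\<lambda>k. a k * fourier_coeff f (n - s k)) sums fourier_coeff (\<lambda>z. g z * f z) n"
    unfolding fourier_coeff_def by simp
qed

lemma fourier_coeff_one: "fourier_coeff (\<lambda>z. 1) n = (if n = 0 then 1 else 0)"
proof (cases "n = 0")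
  case True
  then show ?thesis
    by (simp add: fourier_coeff_def measure_restrict_space scaleR_conv_of_real)
next
  case False
  have "((\<lambda>\<theta>. cis (- (of_int n * \<theta>))) has_integral
          (\<i> / of_int n * cis (- (of_int n * (2*pi))) - \<i> / of_int n * cis (- (of_int n * 0)))) {0..2*pi}"
  proof (rule fundamental_theorem_of_calculus)
    show "((\<lambda>\<theta>. \<i> / of_int n * cis (- (of_int n * \<theta>))) has_vector_derivative
        cis (- (of_int n * \<theta>))) (at \<theta> within {0..2*pi})" for \<theta>
    proof -
      have "((\<lambda>z. \<i> / of_int n * exp (- (\<i> * of_int n * z))) has_field_derivative
          exp (- (\<i> * of_int n * of_real \<theta>))) (at (of_real \<theta>))"
        using False by (auto intro!: derivative_eq_intros simp: field_simps)
      from has_vector_derivative_real_field[OF this] show ?thesis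
        by (simp add: cis_conv_exp mult_ac)
    qed
  qed simp
  moreover have "cis (- (of_int n * (2*pi))) = 1"
    using cis_multiple_2pi[of "- of_int n"] by (simp add: algebra_simps)
  ultimately have "((\<lambda>\<theta>. cis (- (of_int n * \<theta>))) has_integral 0) {0..2*pi}"
    by simp
  moreover have "integrable angles (\<lambda>\<theta>. cis (- (of_int n * \<theta>)))"
    using circle_integrable_cis[OF circle_integrable_const, of 1 "- of_int n"] by simp
  ultimately have "(LINT \<theta>|angles. cis (- (of_int n * \<theta>))) = 0"
    using lebesgue_integral_eq_integral[of "{0..2*pi}" "\<lambda>\<theta>. cis (- (of_int n * \<theta>))"]
    by (simp add: integral_unique)
  with False show ?thesis by (simp add: fourier_coeff_def)
qed

section \<open>Functions with vanishing Fourier coefficients\<close>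

lemma circle_integrable_continuous_mult:
  assumes "circle_integrable f" "continuous_on (sphere 0 1) h"
  shows "circle_integrable (\<lambda>z. h z * f z)"
proof -
  have c: "compact (h ` sphere 0 1)"
    using assms(2) by (intro compact_continuous_image) auto
  then obtain B where B: "\<And>z. z \<in> sphere 0 1 \<Longrightarrow> norm (h z) \<le> B"
    by (meson bounded_iff compact_imp_bounded imageI)
  have m: "(\<lambda>\<theta>. h (cis \<theta>)) \<in> borel_measurable angles"
    by (intro measurable_angles_continuous continuous_on_compose2[OF assms(2)] continuous_intros) auto
  show ?thesis
    unfolding circle_integrable_def
    by (rule integrable_bounded_mult[OF _ m, where B = B])
      (use assms B in \<open>auto simp: circle_integrable_def\<close>)
qed

text \<open>
  Vanishing of all Fourier coefficients is preserved under multiplication by \<open>z\<close> and \<open>cnj z\<close>,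
  hence by real polynomials; this makes Stone-Weierstrass applicable.
\<close>

lemma real_polynomial_function_zero_coeffs:
  assumes "real_polynomial_function p" "circle_integrable f" "\<And>n. fourier_coeff f n = 0"
  shows "circle_integrable (\<lambda>z. of_real (p z) * f z) \<and> (\<forall>n. fourier_coeff (\<lambda>z. of_real (p z) * f z) n = 0)"
  using assms
proof (induction arbitrary: f rule: real_polynomial_function.induct)
  case (linear p)
  \<comment> \<open>Every real linear form on the plane is \<open>2 * Re (\<mu> * z)\<close>, so it
    involves only the multipliers \<open>z\<close> and \<open>cnj z\<close>, which shift the Fourier
    coefficients.\<close>
  define \<mu> where "\<mu> = (of_real (p 1) - \<i> * of_real (p \<i>)) / 2"
  have p: "of_real (p z) = \<mu> * z + cnj \<mu> * cnj z" for z
  proof -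
    have "p z = p (Re z *\<^sub>R 1 + Im z *\<^sub>R \<i>)"
      by (metis complex_eq mult.commute scaleR_conv_of_real mult.right_neutral)
    also have "\<dots> = Re z * p 1 + Im z * p \<i>"
      using linear by (simp add: linear_simps)
    finally show ?thesis
      by (simp add: complex_eq_iff \<mu>_def field_simps)
  qed
  have i: "circle_integrable (\<lambda>z. z * f z)" "circle_integrable (\<lambda>z. cnj z * f z)"
    using linear by (auto intro!: circle_integrable_continuous_mult continuous_intros)
  have eq: "(\<lambda>z. of_real (p z) * f z) = (\<lambda>z. \<mu> * (z * f z) + cnj \<mu> * (cnj z * f z))"
    by (simp add: p algebra_simps)
  show ?case
    unfolding eq using i linear(3)
    by (auto simp: fourier_coeff_add circle_integrable_cmult fourier_coeff_cmult
        fourier_coeff_times_id fourier_coeff_times_cnj)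
next
  case (const c)
  then show ?case by (auto simp: fourier_coeff_cmult)
next
  case (add p q)
  have "(\<lambda>z. of_real (p z + q z) * f z) = (\<lambda>z. of_real (p z) * f z + of_real (q z) * f z)"
    by (simp add: distrib_right)
  with add.IH(1)[OF add.prems] add.IH(2)[OF add.prems] show ?case
    by (simp add: fourier_coeff_add circle_integrable_add)
next
  case (mult p q)
  have "(\<lambda>z. of_real (p z * q z) * f z) = (\<lambda>z. of_real (p z) * (of_real (q z) * f z))"
    by (simp add: mult.assoc)
  with mult.IH(1)[of "\<lambda>z. of_real (q z) * f z"] mult.IH(2)[OF mult.prems] show ?case by simp
qed

lemma fourier_coeff_0: "fourier_coeff f 0 = (LINT \<theta>|angles. f (cis \<theta>)) / of_real (2 * pi)"
  by (simp add: fourier_coeff_def)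

text \<open>For a polynomial \<open>p\<close> within \<open>e\<close> of \<open>h\<close> on the
  circle, the integral of \<open>p * f\<close> is a multiple of a zeroth Fourier coefficient and
  vanishes; the error is at most \<open>e\<close> times the \<open>L1\<close> norm of
  \<open>f\<close>.\<close>

lemma integral_continuous_mult_zero_coeffs:
  fixes h :: "complex \<Rightarrow> real"
  assumes h: "continuous_on (sphere 0 1) h"
    and f: "circle_integrable f" "\<And>n. fourier_coeff f n = 0"
  shows "(LINT \<theta>|angles. of_real (h (cis \<theta>)) * f (cis \<theta>)) = 0"
proof -
  define I where "I = (LINT \<theta>|angles. norm (f (cis \<theta>)))"
  have I: "I \<ge> 0" unfolding I_def by simp
  have hf: "circle_integrable (\<lambda>z. of_real (h z) * f z)"
    using h f by (intro circle_integrable_continuous_mult continuous_intros) auto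
  have "norm (LINT \<theta>|angles. of_real (h (cis \<theta>)) * f (cis \<theta>)) \<le> e * I" if e: "e > 0" for e
  proof -
    obtain p where p: "real_polynomial_function p" "\<And>z. z \<in> sphere 0 1 \<Longrightarrow> \<bar>h z - p z\<bar> < e"
      using Stone_Weierstrass_real_polynomial_function[OF compact_sphere h e] by metis
    have pf: "circle_integrable (\<lambda>z. of_real (p z) * f z)"
      and p0: "fourier_coeff (\<lambda>z. of_real (p z) * f z) 0 = 0"
      using real_polynomial_function_zero_coeffs[OF p(1) f] by auto
    have "(LINT \<theta>|angles. of_real (h (cis \<theta>)) * f (cis \<theta>)) =
      (LINT \<theta>|angles. of_real (h (cis \<theta>)) * f (cis \<theta>) - of_real (p (cis \<theta>)) * f (cis \<theta>))"
      using hf pf p0 by (subst Bochner_Integration.integral_diff) (auto simp: circle_integrable_def fourier_coeff_0)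
    also have "norm \<dots> \<le> (LINT \<theta>|angles. norm (of_real (h (cis \<theta>)) * f (cis \<theta>) - of_real (p (cis \<theta>)) * f (cis \<theta>)))"
      by (rule integral_norm_bound)
    also have "\<dots> \<le> (LINT \<theta>|angles. e * norm (f (cis \<theta>)))"
    proof (rule integral_mono)
      fix \<theta>
      have "norm (of_real (h (cis \<theta>)) * f (cis \<theta>) - of_real (p (cis \<theta>)) * f (cis \<theta>)) =
        \<bar>h (cis \<theta>) - p (cis \<theta>)\<bar> * norm (f (cis \<theta>))"
        by (metis left_diff_distrib norm_mult norm_of_real of_real_diff)
      also have "\<dots> \<le> e * norm (f (cis \<theta>))"
        using p(2)[of "cis \<theta>"] by (intro mult_right_mono) auto
      finally show "norm (of_real (h (cis \<theta>)) * f (cis \<theta>) - of_real (p (cis \<theta>)) * f (cis \<theta>)) \<le> e * norm (f (cis \<theta>))" .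
    qed (use hf pf f in \<open>auto simp: circle_integrable_def\<close>)
    finally show ?thesis by (simp add: I_def)
  qed
  \<comment> \<open>The \<open>L1\<close> norm \<open>I\<close> may be 0, so \<open>e\<close> is
    rescaled by \<open>I + 1\<close>.\<close>
  then have "norm (LINT \<theta>|angles. of_real (h (cis \<theta>)) * f (cis \<theta>)) \<le> 0 + e" if "e > 0" for e
  proof -
    have "e / (I + 1) * I \<le> e"
      using I that by (simp add: field_simps)
    moreover have "e / (I + 1) > 0" using I that by simp
    ultimately show ?thesis
      using \<open>\<And>e. e > 0 \<Longrightarrow> norm (LINT \<theta>|angles. of_real (h (cis \<theta>)) * f (cis \<theta>)) \<le> e * I\<close> by fastforce
  qed
  from field_le_epsilon[OF this] show ?thesis by simp
qed

lemma indicator_measurable_angles: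
  assumes "closed K" "K \<subseteq> {0..2*pi}"
  shows "(indicator K :: real \<Rightarrow> real) \<in> borel_measurable angles"
proof -
  have "K \<in> sets lebesgue" using assms(1) by (simp add: borel_closed)
  then show ?thesis
    using assms(2) by (intro borel_measurable_indicator) (auto simp: sets_restrict_space)
qed

text \<open>Passes from continuous test functions on the circle to indicators of compact sets of
  angles, by dominated convergence.\<close>

lemma integral_compact_zero_coeffs:
  assumes K: "compact K" "K \<subseteq> {0..2*pi}"
    and f: "circle_integrable f" "\<And>n. fourier_coeff f n = 0"
  shows "(LINT \<theta>|angles. indicator K \<theta> *\<^sub>R f (cis \<theta>)) = 0"
proof (cases "K = {}")
  case False
  define C where "C = cis ` K"
  have C: "compact C" "C \<noteq> {}"
    unfolding C_def using K False by (auto intro!: compact_continuous_image continuous_intros)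
  \<comment> \<open>Tent functions: 1 on \<open>C\<close>, and 0 at distance at least
    \<open>1 / k\<close> from it.\<close>
  define h where "h = (\<lambda>k z. max 0 (1 - real k * infdist z C))"
  have hc: "continuous_on (sphere 0 1) (h k)" for k
    unfolding h_def by (intro continuous_intros)
  have hb: "norm (h k z) \<le> 1" for k z
    unfolding h_def using infdist_nonneg[of z C] by (auto simp: max_def)
  have lim: "(\<lambda>k. h k z) \<longlonglongrightarrow> indicator C z" for z
  proof (cases "z \<in> C")
    case True
    then show ?thesis by (simp add: h_def)
  next
    case False
    then have d: "infdist z C > 0"
      using C by (metis compact_imp_closed in_closed_iff_infdist_zero infdist_nonneg order_le_less)
    obtain N where N: "real N * infdist z C > 1"
      using reals_Archimedean3[OF d] by blast
    have "eventually (\<lambda>k. h k z = 0) sequentially"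
      using eventually_ge_at_top[of N]
    proof eventually_elim
      case (elim k)
      then have "real N * infdist z C \<le> real k * infdist z C"
        using d by (intro mult_right_mono) auto
      then show ?case using N by (simp add: h_def)
    qed
    then show ?thesis using False by (simp add: tendsto_eventually)
  qed
  have m: "(\<lambda>\<theta>. f (cis \<theta>)) \<in> borel_measurable angles"
    using f(1) by (auto simp: circle_integrable_def)
  have cm: "cis \<in> borel_measurable angles"
    by (intro measurable_angles_continuous continuous_intros)
  have "(\<lambda>k. LINT \<theta>|angles. of_real (h k (cis \<theta>)) * f (cis \<theta>)) \<longlonglongrightarrow>
      (LINT \<theta>|angles. of_real (indicator C (cis \<theta>)) * f (cis \<theta>))"
  proof (rule integral_dominated_convergence[where w = "\<lambda>\<theta>. norm (f (cis \<theta>))"])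
    have "(\<lambda>\<theta>. indicator C (cis \<theta>) :: real) \<in> borel_measurable angles"
      by (rule measurable_compose[OF cm borel_measurable_indicator]) (use C in \<open>auto intro: borel_closed compact_imp_closed\<close>)
    then show "(\<lambda>\<theta>. complex_of_real (indicator C (cis \<theta>)) * f (cis \<theta>)) \<in> borel_measurable angles"
      using m by measurable
    have "(\<lambda>\<theta>. h k (cis \<theta>)) \<in> borel_measurable angles" for k
      by (intro measurable_angles_continuous continuous_on_compose2[OF hc] continuous_intros) auto
    then show "(\<lambda>\<theta>. complex_of_real (h k (cis \<theta>)) * f (cis \<theta>)) \<in> borel_measurable angles" for k
      using m by measurable
    show "integrable angles (\<lambda>\<theta>. norm (f (cis \<theta>)))"
      using f(1) by (auto simp: circle_integrable_def)
    show "AE \<theta> in angles. (\<lambda>k. complex_of_real (h k (cis \<theta>)) * f (cis \<theta>)) \<longlonglongrightarrow> complex_of_real (indicator C (cis \<theta>)) * f (cis \<theta>)"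
      by (intro AE_I2 tendsto_intros lim)
    show "AE \<theta> in angles. norm (complex_of_real (h k (cis \<theta>)) * f (cis \<theta>)) \<le> norm (f (cis \<theta>))" for k
      using hb by (intro AE_I2) (auto simp: norm_mult intro!: mult_left_le_one_le)
  qed
  then have "(LINT \<theta>|angles. of_real (indicator C (cis \<theta>)) * f (cis \<theta>)) = 0"
    by (simp add: integral_continuous_mult_zero_coeffs[OF hc f] LIMSEQ_const_iff)
  moreover have "(LINT \<theta>|angles. indicator K \<theta> *\<^sub>R f (cis \<theta>)) =
     (LINT \<theta>|angles. of_real (indicator C (cis \<theta>)) * f (cis \<theta>))"
  proof (rule integral_cong_AE)
    have "(indicator K :: real \<Rightarrow> real) \<in> borel_measurable angles"
      using indicator_measurable_angles K by (simp add: compact_imp_closed)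
    then show "(\<lambda>\<theta>. indicator K \<theta> *\<^sub>R f (cis \<theta>)) \<in> borel_measurable angles"
      using m by measurable
    have "(\<lambda>\<theta>. indicator C (cis \<theta>) :: real) \<in> borel_measurable angles"
      by (rule measurable_compose[OF cm borel_measurable_indicator]) (use C in \<open>auto intro: borel_closed compact_imp_closed\<close>)
    then show "(\<lambda>\<theta>. complex_of_real (indicator C (cis \<theta>)) * f (cis \<theta>)) \<in> borel_measurable angles"
      using m by measurable
    \<comment> \<open>The angles 0 and \<open>2*pi\<close> give the same point, so the indicators of
      \<open>C\<close> and \<open>K\<close> can disagree there; at any other angle they
      agree.\<close>
    have "AE \<theta> in lebesgue. \<theta> \<notin> {0, 2*pi}"
      by (rule AE_not_in) (auto intro!: negligible_iff_null_sets[THEN iffD1])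
    then have "AE \<theta> in angles. \<theta> \<notin> {0, 2*pi}"
      by (auto simp: AE_restrict_space_iff elim: eventually_mono)
    moreover have "AE \<theta> in angles. \<theta> \<in> {0..2*pi}"
      by (rule AE_I2) auto
    ultimately show "AE \<theta> in angles. indicator K \<theta> *\<^sub>R f (cis \<theta>) = of_real (indicator C (cis \<theta>)) * f (cis \<theta>)"
    proof eventually_elim
      case (elim \<theta>)
      have "cis \<theta> \<in> C \<longleftrightarrow> \<theta> \<in> K"
      proof
        assume "cis \<theta> \<in> C"
        then obtain x where x: "x \<in> K" "cis \<theta> = cis x" by (auto simp: C_def)
        with K elim have "x \<in> {0..2*pi}" by auto
        from x(2) have sc: "sin \<theta> = sin x" "cos \<theta> = cos x" by (auto simp: complex_eq_iff)
        then obtain m :: int where m: "\<theta> = x + 2 * pi * m"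
          using sin_cos_eq_iff[of \<theta> x] by (auto simp: mult_ac)
        have "\<bar>2 * pi * m\<bar> < 2 * pi"
          using m elim \<open>x \<in> {0..2*pi}\<close> by auto
        then have "\<bar>real_of_int m\<bar> < 1"
          by (simp add: abs_mult)
        then have "m = 0" by linarith
        with m x show "\<theta> \<in> K" by simp
      qed (auto simp: C_def)
      then show ?case by (auto simp: indicator_def)
    qed
  qed
  ultimately show ?thesis by simp
qed auto

text \<open>Up to a null set, a measurable set is an increasing union of compact sets, so the
  integral of \<open>f\<close> over it is a limit of zeros. A function with zero integral over every
  measurable set vanishes almost everywhere.\<close>

theorem fourier_coeff_zero_AE:
  assumes f: "circle_integrable f" "\<And>n. fourier_coeff f n = 0"
  shows "AE \<theta> in angles. f (cis \<theta>) = 0"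
proof (rule sigma_finite_measure.density_zero)
  show "sigma_finite_measure angles"
    using finite_measure_angles by (rule finite_measure.axioms)
  show i: "integrable angles (\<lambda>\<theta>. f (cis \<theta>))" using f by (simp add: circle_integrable_def)
  then have m: "(\<lambda>\<theta>. f (cis \<theta>)) \<in> borel_measurable angles" by auto
  fix A assume "A \<in> sets angles"
  then have A: "A \<in> sets lebesgue" "A \<subseteq> {0..2*pi}"
    by (auto simp: sets_restrict_space)
  obtain C T where CT: "fsigma C" "T \<in> null_sets lebesgue" "C \<union> T = A" "disjnt C T"
    using lebesgue_set_almost_fsigma[OF A(1)] .
  obtain F :: "nat \<Rightarrow> real set" where F: "\<And>n. closed (F n)" "C = \<Union>(range F)"
    using CT(1) by (auto elim!: fsigma.cases)
  define G where "G k = (\<Union>i\<le>k. F i)" for k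
  have G: "compact (G k)" "G k \<subseteq> {0..2*pi}" for k
  proof -
    show "G k \<subseteq> {0..2*pi}" unfolding G_def using F(2) CT(3) A(2) by auto
    then show "compact (G k)"
      unfolding compact_eq_bounded_closed G_def using F(1)
      by (metis bounded_closed_interval bounded_subset closed_UN finite_atMost)
  qed
  have Gm: "(indicator (G k) :: real \<Rightarrow> real) \<in> borel_measurable angles" for k
    using indicator_measurable_angles G[of k] by (simp add: compact_imp_closed)
  have Am: "(indicator A :: real \<Rightarrow> real) \<in> borel_measurable angles"
    using \<open>A \<in> sets angles\<close> by (rule borel_measurable_indicator)
  have "(\<lambda>k. LINT \<theta>|angles. indicator (G k) \<theta> *\<^sub>R f (cis \<theta>)) \<longlonglongrightarrow>
      (LINT \<theta>|angles. indicator A \<theta> *\<^sub>R f (cis \<theta>))"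
  proof (rule integral_dominated_convergence[where w = "\<lambda>\<theta>. norm (f (cis \<theta>))"])
    show "(\<lambda>\<theta>. indicator A \<theta> *\<^sub>R f (cis \<theta>)) \<in> borel_measurable angles"
      using Am m by measurable
    show "(\<lambda>\<theta>. indicator (G k) \<theta> *\<^sub>R f (cis \<theta>)) \<in> borel_measurable angles" for k
      using Gm[of k] m by measurable
    show "integrable angles (\<lambda>\<theta>. norm (f (cis \<theta>)))" using i by simp
    show "AE \<theta> in angles. norm (indicator (G k) \<theta> *\<^sub>R f (cis \<theta>)) \<le> norm (f (cis \<theta>))" for k
      by (intro AE_I2) (auto simp: indicator_def)
    have "AE \<theta> in lebesgue. \<theta> \<notin> T"
      by (rule AE_not_in) (use CT(2) in auto)
    then have "AE \<theta> in angles. \<theta> \<notin> T"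
      by (auto simp: AE_restrict_space_iff elim: eventually_mono)
    then show "AE \<theta> in angles. (\<lambda>k. indicator (G k) \<theta> *\<^sub>R f (cis \<theta>)) \<longlonglongrightarrow> indicator A \<theta> *\<^sub>R f (cis \<theta>)"
    proof eventually_elim
      case (elim \<theta>)
      have "\<exists>N. \<forall>k\<ge>N. (indicator (G k) \<theta> :: real) = indicator A \<theta>"
      proof (cases "\<theta> \<in> A")
        case True
        with elim CT F obtain N where "\<theta> \<in> F N" by auto
        then have "\<theta> \<in> G k" if "k \<ge> N" for k using that by (auto simp: G_def)
        with True show ?thesis by (intro exI[of _ N]) auto
      next
        case False
        then have "\<theta> \<notin> G k" for k using CT F by (auto simp: G_def)
        with False show ?thesis by auto
      qed
      then have "eventually (\<lambda>k. indicator (G k) \<theta> *\<^sub>R f (cis \<theta>) = indicator A \<theta> *\<^sub>R f (cis \<theta>)) sequentially"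
        by (auto simp: eventually_sequentially) 
      then show ?case by (rule tendsto_eventually)
    qed
  qed
  then show "set_lebesgue_integral angles A (\<lambda>\<theta>. f (cis \<theta>)) = 0"
    by (simp add: integral_compact_zero_coeffs[OF G f] LIMSEQ_const_iff set_lebesgue_integral_def)
qed

section \<open>The cubic nonlinearity on the Fourier side\<close>

definition power_series :: "(nat \<Rightarrow> complex) \<Rightarrow> complex \<Rightarrow> complex" where
  "power_series a z = (\<Sum>k. a k * z ^ k)"

text \<open>Mode \<open>n\<close> of \<open>cnj p * p^2\<close> for
  \<open>p = power_series a\<close>; the inner sum is coefficient \<open>n + m\<close> of the
  square. Modes below 0 are those removed by the projector.\<close>

definition cubic_coeff :: "(nat \<Rightarrow> complex) \<Rightarrow> nat \<Rightarrow> complex" where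
  "cubic_coeff a n = (\<Sum>m. cnj (a m) * (\<Sum>k\<le>n + m. a k * a (n + m - k)))"

text \<open>The \<open>case\<close> encodes the shift \<open>S\<close>: mode \<open>m\<close> moves
  to \<open>Suc m\<close>, and nothing lands in mode 0.\<close>

definition beta_szego_field :: "real \<Rightarrow> (nat \<Rightarrow> complex) \<Rightarrow> nat \<Rightarrow> complex" where
  "beta_szego_field \<beta> a n = cubic_coeff a n -
     (case n of 0 \<Rightarrow> 0 | Suc m \<Rightarrow> of_real \<beta> * cubic_coeff (\<lambda>k. a (Suc k)) m)"

lemma power_series_cis:
  "power_series a (cis \<theta>) = (\<Sum>k. a k * cis (of_int (int k) * \<theta>))"
  by (simp add: power_series_def Complex.DeMoivre)

lemma cnj_power_series_cis:
  assumes "summable (\<lambda>k. norm (a k))"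
  shows "cnj (power_series a (cis \<theta>)) = (\<Sum>k. cnj (a k) * cis (of_int (- int k) * \<theta>))"
proof -
  have "summable (\<lambda>k. a k * cis (of_int (int k) * \<theta>))"
    by (rule summable_norm_cancel) (use assms in \<open>simp add: norm_mult\<close>)
  from sums_cnj[THEN iffD2, OF summable_sums[OF this]] show ?thesis
    by (simp add: power_series_cis sums_iff cis_cnj)
qed

lemma
  assumes a: "summable (\<lambda>k. norm (a k))"
  shows circle_integrable_power_series: "circle_integrable (power_series a)"
    and fourier_coeff_power_series:
      "fourier_coeff (power_series a) n = (if n \<ge> 0 then a (nat n) else 0)"
proof -
  note * = fourier_coeff_trig_series_mult[OF a circle_integrable_const[of 1], of "power_series a" int,
      OF power_series_cis]
  show "circle_integrable (power_series a)" using *(1) by simp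
  have eq: "a k * fourier_coeff (\<lambda>z. 1) (n - int k) = (if n \<ge> 0 \<and> k = nat n then a k else 0)" for k
    by (auto simp: fourier_coeff_one)
  have "(\<lambda>k. if n \<ge> 0 \<and> k = nat n then a k else 0) sums (if n \<ge> 0 then a (nat n) else 0)"
    using sums_single[of "nat n" a] by (cases "n \<ge> 0") (auto intro: sums_zero)
  with *(2)[of n] show "fourier_coeff (power_series a) n = (if n \<ge> 0 then a (nat n) else 0)"
    unfolding eq by (simp add: sums_unique2)
qed

text \<open>The uniqueness theorem applied to the difference. It is what allows
  \<open>cubic f\<close>, which depends on point values, to be computed from the Fourier
  coefficients of \<open>f\<close>.\<close>

lemma L2_plus_AE_power_series:
  assumes f: "f \<in> L2_plus" and s: "summable (\<lambda>k. norm (fourier_coeff f (int k)))"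
  shows "AE \<theta> in angles. f (cis \<theta>) = power_series (\<lambda>k. fourier_coeff f (int k)) (cis \<theta>)"
proof -
  let ?p = "power_series (\<lambda>k. fourier_coeff f (int k))"
  have i: "circle_integrable f" "circle_integrable ?p"
    using f by (auto simp: L2_plus_def intro: circle_integrable_L2 circle_integrable_power_series[OF s])
  have "AE \<theta> in angles. f (cis \<theta>) - ?p (cis \<theta>) = 0"
  proof (rule fourier_coeff_zero_AE)
    show "circle_integrable (\<lambda>z. f z - ?p z)" using i by auto
    show "fourier_coeff (\<lambda>z. f z - ?p z) n = 0" for n
      using f by (auto simp: fourier_coeff_diff[OF i] fourier_coeff_power_series[OF s] L2_plus_def)
  qed
  then show ?thesis by simp
qed

text \<open>Multiplication by the series twice: \<open>p\<close> by \<open>p\<close>, which gives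
  the Cauchy product, and the result by \<open>cnj p\<close>, which gives the outer sum over
  \<open>m\<close>.\<close>

lemma fourier_coeff_cubic_power_series:
  assumes a: "summable (\<lambda>k. norm (a k))"
  shows "fourier_coeff (cubic (power_series a)) (int n) = cubic_coeff a n"
proof -
  let ?p = "power_series a"
  note sq = fourier_coeff_trig_series_mult[OF a circle_integrable_power_series[OF a],
      of ?p int, OF power_series_cis]
  have "summable (\<lambda>k. norm (cnj (a k)))" using a by simp
  note cu = fourier_coeff_trig_series_mult[OF this sq(1), of "\<lambda>z. cnj (?p z)" "\<lambda>k. - int k",
      OF cnj_power_series_cis[OF a]]
  have cubic: "cubic ?p = (\<lambda>z. cnj (?p z) * (?p z * ?p z))"
    unfolding cubic_def complex_norm_square by (simp add: mult_ac)
  have "fourier_coeff (\<lambda>z. ?p z * ?p z) (int j) = (\<Sum>k\<le>j. a k * a (j - k))" for j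
  proof -
    have "(\<lambda>k. a k * fourier_coeff ?p (int j - int k)) sums (\<Sum>k\<le>j. a k * fourier_coeff ?p (int j - int k))"
      by (rule sums_finite) (auto simp: fourier_coeff_power_series[OF a])
    with sq(2)[of "int j"] have "fourier_coeff (\<lambda>z. ?p z * ?p z) (int j) = (\<Sum>k\<le>j. a k * fourier_coeff ?p (int j - int k))"
      by (rule sums_unique2)
    also have "\<dots> = (\<Sum>k\<le>j. a k * a (j - k))"
      by (rule sum.cong) (auto simp: fourier_coeff_power_series[OF a] nat_diff_distrib)
    finally show ?thesis .
  qed
  from this[of "n + m" for m] cu(2)[of "int n"]
  show "fourier_coeff (cubic ?p) (int n) = cubic_coeff a n"
    by (simp add: cubic cubic_coeff_def sums_iff)
qed

text \<open>Young's inequality in \<open>l^1\<close>: the Cauchy square \<open>g\<close> of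
  \<open>a\<close> is summable, and correlating it with \<open>a\<close> costs at most the factor
  \<open>A\<close>, since each shifted sum of \<open>norm (g (n + m))\<close> over \<open>n\<close>
  is at most \<open>G\<close>.\<close>

lemma summable_cubic_coeff:
  assumes a: "summable (\<lambda>k. norm (a k))"
  shows "summable (\<lambda>n. norm (cubic_coeff a n))"
proof -
  define g where "g j = (\<Sum>k\<le>j. a k * a (j - k))" for j
  have "summable (\<lambda>j. \<Sum>k\<le>j. norm (a k) * norm (a (j - k)))"
    using a by (intro summable_Cauchy_product) auto
  then have g: "summable (\<lambda>j. norm (g j))"
    unfolding g_def by (rule summable_comparison_test[rotated])
      (auto intro!: exI[of _ 0] order.trans[OF norm_sum] simp: norm_mult)
  define A G where "A = (\<Sum>k. norm (a k))" and "G = (\<Sum>j. norm (g j))"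
  have gb: "norm (g j) \<le> G" for j
    unfolding G_def using sum_le_suminf[OF g, of "{j}"] by simp
  have sm: "summable (\<lambda>m. norm (a m) * norm (g (n + m)))" for n
    by (rule summable_comparison_test[OF _ summable_mult2[OF a, of G]])
      (auto intro!: exI[of _ 0] mult_left_mono gb)
  have le: "norm (cubic_coeff a n) \<le> (\<Sum>m. norm (a m) * norm (g (n + m)))" for n
  proof -
    have "cubic_coeff a n = (\<Sum>m. cnj (a m) * g (n + m))" by (simp add: cubic_coeff_def g_def)
    also have "norm \<dots> \<le> (\<Sum>m. norm (cnj (a m) * g (n + m)))"
      by (rule summable_norm) (use sm[of n] in \<open>simp add: norm_mult\<close>)
    finally show ?thesis by (simp add: norm_mult)
  qed
  have "(\<Sum>n<N. norm (cubic_coeff a n)) \<le> A * G" for N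
  proof -
    have "(\<Sum>n<N. norm (cubic_coeff a n)) \<le> (\<Sum>n<N. \<Sum>m. norm (a m) * norm (g (n + m)))"
      by (intro sum_mono le)
    also have "\<dots> = (\<Sum>m. \<Sum>n<N. norm (a m) * norm (g (n + m)))"
      by (intro suminf_sum[symmetric] sm)
    also have "\<dots> \<le> (\<Sum>m. norm (a m) * G)"
    proof (rule suminf_le)
      show "summable (\<lambda>m. \<Sum>n<N. norm (a m) * norm (g (n + m)))" by (intro summable_sum sm)
      show "summable (\<lambda>m. norm (a m) * G)" using a by (intro summable_mult2)
      fix m
      have "(\<Sum>n<N. norm (g (n + m))) = sum (\<lambda>j. norm (g j)) ((\<lambda>n. n + m) ` {..<N})"
        by (subst sum.reindex) auto
      also have "\<dots> \<le> G" unfolding G_def by (rule sum_le_suminf[OF g]) auto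
      finally show "(\<Sum>n<N. norm (a m) * norm (g (n + m))) \<le> norm (a m) * G"
        unfolding sum_distrib_left[symmetric] by (rule mult_left_mono) auto
    qed
    also have "\<dots> = A * G" unfolding A_def by (rule suminf_mult2[symmetric, OF a])
    finally show ?thesis .
  qed
  then show ?thesis
    by (intro summableI_nonneg_bounded) auto
qed

lemma summable_beta_szego_field:
  assumes a: "summable (\<lambda>k. norm (a k))"
  shows "summable (\<lambda>n. norm (beta_szego_field \<beta> a n))"
proof -
  have "summable (\<lambda>k. norm (a (Suc k)))" using a summable_Suc_iff[of "\<lambda>k. norm (a k)"] by simp
  then have "summable (\<lambda>n. norm (cubic_coeff (\<lambda>k. a (Suc k)) n))" by (rule summable_cubic_coeff)
  then have "summable (\<lambda>n. norm (cubic_coeff a (Suc n)) + \<bar>\<beta>\<bar> * norm (cubic_coeff (\<lambda>k. a (Suc k)) n))"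
    using summable_cubic_coeff[OF a] summable_Suc_iff[of "\<lambda>n. norm (cubic_coeff a n)"]
    by (intro summable_add summable_mult) auto
  then have "summable (\<lambda>n. norm (beta_szego_field \<beta> a (Suc n)))"
  proof (rule summable_comparison_test[rotated], intro exI[of _ 0] allI impI)
    fix n
    have "norm (beta_szego_field \<beta> a (Suc n)) \<le> norm (cubic_coeff a (Suc n)) + norm (of_real \<beta> * cubic_coeff (\<lambda>k. a (Suc k)) n)"
      unfolding beta_szego_field_def nat.case by (rule norm_triangle_ineq4)
    then show "norm (norm (beta_szego_field \<beta> a (Suc n))) \<le> norm (cubic_coeff a (Suc n)) + \<bar>\<beta>\<bar> * norm (cubic_coeff (\<lambda>k. a (Suc k)) n)"
      by (simp add: norm_mult)
  qed
  then show ?thesis using summable_Suc_iff[of "\<lambda>n. norm (beta_szego_field \<beta> a n)"] by simp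
qed

text \<open>Valid at every point of the circle although \<open>f\<close> is known only almost
  everywhere: both operators in the right-hand side return sums of series whose coefficients are
  integrals. \<open>adj_shift f\<close> is a power series outright, so only \<open>cubic f\<close>
  requires an almost-everywhere argument.\<close>

lemma beta_szego_rhs_eq_power_series:
  assumes f: "f \<in> L2_plus" and s: "summable (\<lambda>k. norm (fourier_coeff f (int k)))"
    and z: "norm z = 1"
  defines "a \<equiv> \<lambda>k. fourier_coeff f (int k)"
  shows "beta_szego_rhs \<beta> f z = power_series (beta_szego_field \<beta> a) z"
proof -
  have a: "summable (\<lambda>k. norm (a k))" using s by (simp add: a_def)
  then have a': "summable (\<lambda>k. norm (a (Suc k)))"
    using summable_Suc_iff[of "\<lambda>k. norm (a k)"] by simp
  have m: "(\<lambda>\<theta>. f (cis \<theta>)) \<in> borel_measurable angles"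
    using f by (auto simp: L2_plus_def L2_circle_def)
  have mp: "(\<lambda>\<theta>. power_series a (cis \<theta>)) \<in> borel_measurable angles"
    using circle_integrable_power_series[OF a] by (auto simp: circle_integrable_def)
  have "fourier_coeff (cubic f) (int n) = fourier_coeff (cubic (power_series a)) (int n)" for n
  proof (rule fourier_coeff_cong_AE)
    show "AE \<theta> in angles. cubic f (cis \<theta>) = cubic (power_series a) (cis \<theta>)"
      using L2_plus_AE_power_series[OF f s] unfolding a_def
      by eventually_elim (simp add: cubic_def)
  qed (use m mp in \<open>unfold cubic_def, measurable\<close>)
  then have c: "fourier_coeff (cubic f) (int n) = cubic_coeff a n" for n
    by (simp add: fourier_coeff_cubic_power_series[OF a])
  have "adj_shift f = power_series (\<lambda>k. a (Suc k))"
    by (auto simp: fun_eq_iff adj_shift_def power_series_def a_def add.commute)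
  then have c': "fourier_coeff (cubic (adj_shift f)) (int n) = cubic_coeff (\<lambda>k. a (Suc k)) n" for n
    by (simp add: fourier_coeff_cubic_power_series[OF a'])
  have sz: "summable (\<lambda>n. b n * z ^ n)" if "summable (\<lambda>n. norm (b n))" for b
    by (rule summable_norm_cancel) (use that z in \<open>simp add: norm_mult norm_power\<close>)
  note sc = sz[OF summable_cubic_coeff[OF a]] and sc' = sz[OF summable_cubic_coeff[OF a']]
  note sF = sz[OF summable_beta_szego_field[OF a, of \<beta>]]
  have "beta_szego_rhs \<beta> f z =
      (\<Sum>n. cubic_coeff a n * z ^ n) - of_real \<beta> * (z * (\<Sum>n. cubic_coeff (\<lambda>k. a (Suc k)) n * z ^ n))"
    by (simp add: beta_szego_rhs_def szego_proj_def shift_def c c')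
  also have "(\<Sum>n. cubic_coeff a n * z ^ n) = (\<Sum>n. cubic_coeff a (Suc n) * z ^ Suc n) + cubic_coeff a 0"
    using suminf_split_head[OF sc] by simp
  also have "of_real \<beta> * (z * (\<Sum>n. cubic_coeff (\<lambda>k. a (Suc k)) n * z ^ n)) =
      (\<Sum>n. of_real \<beta> * z * (cubic_coeff (\<lambda>k. a (Suc k)) n * z ^ n))"
    using suminf_mult[OF sc', of "of_real \<beta> * z"] by (simp add: mult.assoc)
  also have "(\<Sum>n. cubic_coeff a (Suc n) * z ^ Suc n) + cubic_coeff a 0 - \<dots> =
      (\<Sum>n. cubic_coeff a (Suc n) * z ^ Suc n - of_real \<beta> * z * (cubic_coeff (\<lambda>k. a (Suc k)) n * z ^ n)) + cubic_coeff a 0"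
    using sc sc' by (subst suminf_diff[symmetric]) (auto simp: summable_Suc_iff intro!: summable_mult simp del: power_Suc
        dest: summable_Suc_iff[THEN iffD2])
  also have "\<dots> = (\<Sum>n. beta_szego_field \<beta> a (Suc n) * z ^ Suc n) + beta_szego_field \<beta> a 0"
    by (simp add: beta_szego_field_def algebra_simps)
  also have "\<dots> = (\<Sum>n. beta_szego_field \<beta> a n * z ^ n)"
    using suminf_split_head[OF sF] by simp
  finally show ?thesis by (simp add: power_series_def)
qed

section \<open>From solutions in \<open>Hs_plus \<sigma>\<close> to an infinite system for the
  coefficients\<close>

lemma summable_weight:
  assumes "\<sigma> > 1/2"
  shows "summable (\<lambda>n. (1 + real n) powr (- (2 * \<sigma>)))"
proof -
  have "summable (\<lambda>n. real n powr (- (2 * \<sigma>)))"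
    using assms by (simp add: summable_real_powr_iff)
  then have "summable (\<lambda>n. real (Suc n) powr (- (2 * \<sigma>)))"
    by (subst summable_Suc_iff)
  then show ?thesis by (simp add: add.commute)
qed

text \<open>Cauchy-Schwarz against the weight \<open>(1 + real n) powr (- \<sigma>)\<close>, square
  summable because \<open>2 * \<sigma> > 1\<close>. The explicit constant later turns continuity in
  the Sobolev norm into a local \<open>l^1\<close> bound.\<close>

lemma weighted_l2_imp_l1:
  fixes a :: "nat \<Rightarrow> complex"
  assumes \<sigma>: "\<sigma> > 1/2" and s: "summable (\<lambda>n. (1 + real n) powr (2 * \<sigma>) * (norm (a n))\<^sup>2)"
  shows "summable (\<lambda>n. norm (a n))"
    and "(\<Sum>n. norm (a n)) \<le> sqrt (\<Sum>n. (1 + real n) powr (- (2 * \<sigma>))) *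
      sqrt (\<Sum>n. (1 + real n) powr (2 * \<sigma>) * (norm (a n))\<^sup>2)" (is "_ \<le> sqrt ?W * sqrt ?H")
proof -
  have "(\<Sum>n<N. norm (a n)) \<le> sqrt ?W * sqrt ?H" for N
  proof -
    have eq: "norm (a n) = (1 + real n) powr (- \<sigma>) * ((1 + real n) powr \<sigma> * norm (a n))" for n
      by (simp add: powr_minus)
    have "(\<Sum>n<N. norm (a n))\<^sup>2 = (\<Sum>n<N. (1 + real n) powr (- \<sigma>) * ((1 + real n) powr \<sigma> * norm (a n)))\<^sup>2"
      by (simp only: eq[symmetric])
    also have "\<dots> \<le> (\<Sum>n<N. ((1 + real n) powr (- \<sigma>))\<^sup>2) * (\<Sum>n<N. ((1 + real n) powr \<sigma> * norm (a n))\<^sup>2)"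
      by (rule Cauchy_Schwarz_ineq_sum)
    also have "\<dots> = (\<Sum>n<N. (1 + real n) powr (- (2 * \<sigma>))) * (\<Sum>n<N. (1 + real n) powr (2 * \<sigma>) * (norm (a n))\<^sup>2)"
      by (simp add: power_mult_distrib powr_power mult.commute)
    also have "\<dots> \<le> ?W * ?H"
      by (intro mult_mono sum_le_suminf summable_weight[OF \<sigma>] s sum_nonneg suminf_nonneg) auto
    finally have "sqrt ((\<Sum>n<N. norm (a n))\<^sup>2) \<le> sqrt (?W * ?H)"
      by (rule real_sqrt_le_mono)
    then show ?thesis by (simp add: real_sqrt_mult sum_nonneg)
  qed
  then show "summable (\<lambda>n. norm (a n))"
    by (intro summableI_nonneg_bounded) auto
  then show "(\<Sum>n. norm (a n)) \<le> sqrt ?W * sqrt ?H"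
    using \<open>\<And>N. (\<Sum>n<N. norm (a n)) \<le> sqrt ?W * sqrt ?H\<close> by (intro suminf_le_const) auto
qed

lemma summable_square_of_l1:
  fixes a :: "nat \<Rightarrow> complex"
  assumes "summable (\<lambda>n. norm (a n))"
  shows "summable (\<lambda>n. (norm (a n))\<^sup>2)"
proof (rule summable_comparison_test_ev[OF _ assms])
  have "eventually (\<lambda>n. norm (a n) < 1) sequentially"
    using order_tendstoD(2)[OF summable_LIMSEQ_zero[OF assms], of 1] by simp
  then show "eventually (\<lambda>n. norm ((norm (a n))\<^sup>2) \<le> norm (a n)) sequentially"
    by eventually_elim (simp add: power2_eq_square mult_left_le)
qed

text \<open>Carries the \<open>L2\<close> limit in the time derivative over to single modes.
  Summability is assumed because \<open>Hs_norm\<close> is an infinite sum and bounds nothing when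
  that sum diverges.\<close>

lemma norm_fourier_coeff_le_Hs_norm_0:
  assumes "summable (\<lambda>n. norm (fourier_coeff f (int n)))"
  shows "norm (fourier_coeff f (int n)) \<le> Hs_norm 0 f"
proof -
  have "(norm (fourier_coeff f (int n)))\<^sup>2 \<le> (\<Sum>n. (norm (fourier_coeff f (int n)))\<^sup>2)"
    using sum_le_suminf[OF summable_square_of_l1[OF assms], of "{n}"] by simp
  then show ?thesis
    by (simp add: Hs_norm_def real_le_rsqrt)
qed

lemma has_vector_derivative_of_quotient_limit:
  fixes f :: "real \<Rightarrow> complex"
  assumes "((\<lambda>h. (f (t + h) - f t) / of_real h - D) \<longlongrightarrow> 0) (at 0)"
  shows "(f has_vector_derivative D) (at t)"
proof -
  have "((\<lambda>h. norm (f (t + h) - f t - h *\<^sub>R D) / norm h) \<longlongrightarrow> 0) (at 0)"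
  proof (rule Lim_transform_eventually[OF tendsto_norm_zero[OF assms]])
    show "eventually (\<lambda>h. norm ((f (t + h) - f t) / of_real h - D) = norm (f (t + h) - f t - h *\<^sub>R D) / norm h) (at 0)"
    proof (rule eventually_at_filter[THEN iffD2], intro always_eventually allI impI)
      fix h :: real assume "h \<noteq> 0"
      then have "(f (t + h) - f t) / of_real h - D = (f (t + h) - f t - h *\<^sub>R D) / of_real h"
        by (simp add: diff_divide_distrib scaleR_conv_of_real)
      then show "norm ((f (t + h) - f t) / of_real h - D) = norm (f (t + h) - f t - h *\<^sub>R D) / norm h"
        by (simp add: norm_divide)
    qed
  qed
  then show ?thesis
    unfolding has_vector_derivative_def has_derivative_at by (simp add: bounded_linear_scaleR_left)
qed

text \<open>The three conclusions are the assumptions of the locale \<open>beta_szego_flow\<close>.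
  The second comes from the \<open>L2\<close> derivative, the third from continuity in the norm of
  index \<sigma>.\<close>

lemma beta_szego_solution_coeffs:
  assumes \<sigma>: "\<sigma> > 1/2" and sol: "beta_szego_solution \<sigma> \<beta> u"
  defines "a \<equiv> \<lambda>t n. fourier_coeff (u t) (int n)"
  shows "summable (\<lambda>n. norm (a t n))"
    and "((\<lambda>\<tau>. a \<tau> n) has_vector_derivative - \<i> * beta_szego_field \<beta> (a t) n) (at t)"
    and "\<exists>A. eventually (\<lambda>\<tau>. (\<Sum>n. norm (a \<tau> n)) \<le> A) (at t)"
proof -
  have Hs: "u t \<in> Hs_plus \<sigma>" for t
    using sol by (auto simp: beta_szego_solution_def)
  then have L2: "u t \<in> L2_plus" for t by (auto simp: Hs_plus_def)
  then have int: "circle_integrable (u t)" for t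
    by (auto simp: L2_plus_def intro: circle_integrable_L2)
  have sm: "summable (\<lambda>n. norm (a t n))" for t
    using Hs[of t] by (auto simp: Hs_plus_def a_def intro: weighted_l2_imp_l1(1)[OF \<sigma>])
  then show "summable (\<lambda>n. norm (a t n))" .

  have rhs: "circle_integrable (beta_szego_rhs \<beta> (u t))"
    "fourier_coeff (beta_szego_rhs \<beta> (u t)) (int n) = beta_szego_field \<beta> (a t) n" for n
  proof -
    have eq: "beta_szego_rhs \<beta> (u t) (cis \<theta>) = power_series (beta_szego_field \<beta> (a t)) (cis \<theta>)" for \<theta>
      unfolding a_def by (rule beta_szego_rhs_eq_power_series[OF L2 sm[unfolded a_def]]) simp
    note p = summable_beta_szego_field[OF sm[of t], of \<beta>]
    show "circle_integrable (beta_szego_rhs \<beta> (u t))"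
      using circle_integrable_power_series[OF p] by (simp add: circle_integrable_def eq)
    show "fourier_coeff (beta_szego_rhs \<beta> (u t)) (int n) = beta_szego_field \<beta> (a t) n"
      using fourier_coeff_power_series[OF p, of "int n"] by (simp add: fourier_coeff_def eq)
  qed
  let ?g = "\<lambda>h z. (\<i> * u (t + h) z - \<i> * u t z) / of_real h - beta_szego_rhs \<beta> (u t) z"
  \<comment> \<open>Division by zero yields 0, so the formula also holds for \<open>h = 0\<close>
    and the limits below need no exception.\<close>
  have g: "fourier_coeff (?g h) (int n) = \<i> * ((a (t + h) n - a t n) / of_real h + \<i> * beta_szego_field \<beta> (a t) n)" for h n
  proof -
    have "?g h = (\<lambda>z. (\<i> / of_real h) * (u (t + h) z - u t z) - beta_szego_rhs \<beta> (u t) z)"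
      by (simp add: right_diff_distrib diff_divide_distrib)
    then have "fourier_coeff (?g h) (int n) =
        fourier_coeff (\<lambda>z. (\<i> / of_real h) * (u (t + h) z - u t z) - beta_szego_rhs \<beta> (u t) z) (int n)"
      by (simp only:)
    also have "\<dots> = (\<i> / of_real h) * (a (t + h) n - a t n) - beta_szego_field \<beta> (a t) n"
      unfolding fourier_coeff_diff[OF circle_integrable_cmult[OF circle_integrable_diff[OF int int]] rhs(1)]
        fourier_coeff_cmult fourier_coeff_diff[OF int int] rhs(2) a_def ..
    also have "\<dots> = \<i> * ((a (t + h) n - a t n) / of_real h + \<i> * beta_szego_field \<beta> (a t) n)"
      by (simp add: algebra_simps diff_divide_distrib)
    finally show ?thesis .
  qed
  have gs: "summable (\<lambda>n. norm (fourier_coeff (?g h) (int n)))" for h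
  proof -
    have "summable (\<lambda>n. (norm (a (t + h) n) + norm (a t n)) / \<bar>h\<bar> + norm (beta_szego_field \<beta> (a t) n))"
      by (intro summable_add summable_divide sm summable_beta_szego_field)
    then show ?thesis
      by (rule summable_comparison_test[rotated])
        (auto simp: g norm_mult norm_divide intro!: exI[of _ 0] order.trans[OF norm_triangle_ineq] add_right_mono divide_right_mono norm_triangle_ineq4)
  qed
  have lim: "((\<lambda>h. Hs_norm 0 (?g h)) \<longlongrightarrow> 0) (at 0)"
    using sol by (auto simp: beta_szego_solution_def has_L2_time_derivative_def)
  have "((\<lambda>h. fourier_coeff (?g h) (int n)) \<longlongrightarrow> 0) (at 0)"
    by (rule Lim_null_comparison[OF _ lim]) (intro always_eventually allI norm_fourier_coeff_le_Hs_norm_0 gs)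
  then have "((\<lambda>h. - \<i> * fourier_coeff (?g h) (int n)) \<longlongrightarrow> 0) (at 0)"
    by (rule tendsto_mult_right_zero)
  then have "((\<lambda>h. (a (t + h) n - a t n) / of_real h - (- \<i> * beta_szego_field \<beta> (a t) n)) \<longlongrightarrow> 0) (at 0)"
    unfolding g by (simp add: add.commute)
  then show "((\<lambda>\<tau>. a \<tau> n) has_vector_derivative - \<i> * beta_szego_field \<beta> (a t) n) (at t)"
    by (rule has_vector_derivative_of_quotient_limit)

  define W where "W = sqrt (\<Sum>n. (1 + real n) powr (- (2 * \<sigma>)))"
  have W: "W \<ge> 0" unfolding W_def by (intro real_sqrt_ge_zero suminf_nonneg summable_weight[OF \<sigma>]) auto
  have "((\<lambda>\<tau>. Hs_norm \<sigma> (\<lambda>z. u \<tau> z - u t z)) \<longlongrightarrow> 0) (at t)"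
    using sol by (auto simp: beta_szego_solution_def)
  from order_tendstoD(2)[OF this, of 1]
  have ev: "eventually (\<lambda>\<tau>. Hs_norm \<sigma> (\<lambda>z. u \<tau> z - u t z) < 1) (at t)" by simp
  \<comment> \<open>Sobolev distance below 1 means \<open>l^1\<close> distance at most
    \<open>W\<close>.\<close>
  have "(\<Sum>n. norm (a \<tau> n)) \<le> W + (\<Sum>n. norm (a t n))" if *: "Hs_norm \<sigma> (\<lambda>z. u \<tau> z - u t z) < 1" for \<tau>
  proof -
    have d: "fourier_coeff (\<lambda>z. u \<tau> z - u t z) (int n) = a \<tau> n - a t n" for n
      using int by (simp add: fourier_coeff_diff a_def)
    have s: "summable (\<lambda>n. (1 + real n) powr (2 * \<sigma>) * (norm (a \<tau> n - a t n))\<^sup>2)"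
    proof (rule summable_comparison_test)
      show "summable (\<lambda>n. 2 * ((1 + real n) powr (2 * \<sigma>) * (norm (a \<tau> n))\<^sup>2) + 2 * ((1 + real n) powr (2 * \<sigma>) * (norm (a t n))\<^sup>2))"
        using Hs by (intro summable_add summable_mult) (auto simp: Hs_plus_def a_def)
      have "(norm (x - y))\<^sup>2 \<le> 2 * (norm x)\<^sup>2 + 2 * (norm y)\<^sup>2" for x y :: complex
      proof -
        have "(norm (x - y))\<^sup>2 \<le> (norm x + norm y)\<^sup>2"
          by (intro power_mono norm_triangle_ineq4) auto
        also have "\<dots> \<le> 2 * (norm x)\<^sup>2 + 2 * (norm y)\<^sup>2"
          using zero_le_power2[of "norm x - norm y"] by (simp add: power2_sum power2_diff)
        finally show ?thesis .
      qed
      from mult_left_mono[OF this, of "(1 + real n) powr (2 * \<sigma>)" "a \<tau> n" "a t n" for n]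
      show "\<exists>N. \<forall>n\<ge>N. norm ((1 + real n) powr (2 * \<sigma>) * (norm (a \<tau> n - a t n))\<^sup>2) \<le>
         2 * ((1 + real n) powr (2 * \<sigma>) * (norm (a \<tau> n))\<^sup>2) + 2 * ((1 + real n) powr (2 * \<sigma>) * (norm (a t n))\<^sup>2)"
        by (auto simp: algebra_simps)
    qed
    note w = weighted_l2_imp_l1[OF \<sigma> s]
    have "(\<Sum>n. norm (a \<tau> n - a t n)) \<le> W * Hs_norm \<sigma> (\<lambda>z. u \<tau> z - u t z)"
      using w(2) unfolding W_def Hs_norm_def d .
    also have "\<dots> \<le> W" using W * by (simp add: mult_left_le)
    finally have "(\<Sum>n. norm (a \<tau> n - a t n)) \<le> W" .
    moreover have "(\<Sum>n. norm (a \<tau> n)) \<le> (\<Sum>n. norm (a \<tau> n - a t n) + norm (a t n))"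
    proof (rule suminf_le)
      show "norm (a \<tau> n) \<le> norm (a \<tau> n - a t n) + norm (a t n)" for n
        using norm_triangle_ineq[of "a \<tau> n - a t n" "a t n"] by simp
    qed (intro sm w(1) summable_add)+
    ultimately show ?thesis
      using suminf_add[OF w(1) sm[of t]] by simp
  qed
  with ev show "\<exists>A. eventually (\<lambda>\<tau>. (\<Sum>n. norm (a \<tau> n)) \<le> A) (at t)"
    by (blast intro: eventually_mono)
qed

section \<open>The Hankel matrix has rank one for all times\<close>

lemma norm_le_of_vector_derivative_bound:
  fixes f :: "real \<Rightarrow> complex"
  assumes "convex S" "x \<in> S" "y \<in> S"
    and "\<And>z. z \<in> S \<Longrightarrow> (f has_vector_derivative f' z) (at z)"
    and "\<And>z. z \<in> S \<Longrightarrow> norm (f' z) \<le> B"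
  shows "norm (f x - f y) \<le> B * \<bar>x - y\<bar>"
proof -
  have "norm (f x - f y) \<le> B * norm (x - y)"
  proof (rule differentiable_bound[OF assms(1) _ _ assms(2,3)])
    show "(f has_derivative (\<lambda>h. h *\<^sub>R f' z)) (at z within S)" if "z \<in> S" for z
      using assms(4)[OF that] has_derivative_at_withinI by (auto simp: has_vector_derivative_def)
    show "onorm (\<lambda>h. h *\<^sub>R f' z) \<le> B" if "z \<in> S" for z
      using mult_left_mono[OF assms(5)[OF that]] by (intro onorm_le) (simp add: mult.commute[of B])
  qed
  then show ?thesis by simp
qed

text \<open>The set of times at which the whole family vanishes is closed by continuity and open by
  a Picard-type iteration, hence is the whole line. The condition quantified over \<open>b\<close>
  says that the supremum of the derivatives is at most \<open>C\<close> times the supremum of the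
  family, without naming a supremum, about whose regularity in time nothing is known.\<close>

lemma linear_family_zero:
  fixes f :: "'i \<Rightarrow> real \<Rightarrow> complex"
  assumes der: "\<And>i t. (f i has_vector_derivative f' i t) (at t)"
    and loc: "\<And>t. \<exists>e>0. \<exists>B C. \<forall>\<tau>. \<bar>\<tau> - t\<bar> < e \<longrightarrow> (\<forall>i. norm (f i \<tau>) \<le> B) \<and>
      (\<forall>b. (\<forall>i. norm (f i \<tau>) \<le> b) \<longrightarrow> (\<forall>i. norm (f' i \<tau>) \<le> C * b))"
    and zero: "\<And>i. f i t0 = 0"
  shows "f i t = 0"
proof -
  define Z where "Z = {t. \<forall>i. f i t = 0}"
  have cont: "continuous_on UNIV (f i)" for i
    using der by (meson continuous_at_imp_continuous_on has_vector_derivative_continuous)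
  have "closed Z"
  proof -
    have "Z = (\<Inter>i. {t. f i t = 0})" by (auto simp: Z_def)
    then show ?thesis using cont by (auto intro!: closed_INT closed_Collect_eq continuous_intros)
  qed
  moreover have "open Z"
    unfolding open_dist
  proof
    fix t assume t: "t \<in> Z"
    obtain e B C where e: "e > 0"
      and B: "\<And>\<tau> i. \<bar>\<tau> - t\<bar> < e \<Longrightarrow> norm (f i \<tau>) \<le> B"
      and C: "\<And>\<tau> b i. \<bar>\<tau> - t\<bar> < e \<Longrightarrow> (\<And>i. norm (f i \<tau>) \<le> b) \<Longrightarrow> norm (f' i \<tau>) \<le> C * b"
      using loc[of t] by metis
    \<comment> \<open>\<open>C\<close> may be nonpositive, hence the maximum with 1;
      \<open>d\<close> is small enough that one use of the mean value inequality halves a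
      bound.\<close>
    define D where "D = max C 1"
    define d where "d = min e (1 / (2 * D))"
    have D: "D \<ge> 1" "C \<le> D" by (auto simp: D_def)
    have d: "d > 0" "d \<le> e" "D * d \<le> 1 / 2"
    proof -
      show "d > 0" "d \<le> e" using e D by (auto simp: d_def)
      have "D * d \<le> D * (1 / (2 * D))" using D by (intro mult_left_mono) (auto simp: d_def)
      then show "D * d \<le> 1 / 2" using D by simp
    qed
    have B0: "B \<ge> 0" using B[of t undefined] e by (auto intro: order.trans[OF norm_ge_zero])
    \<comment> \<open>All members vanish at \<open>t\<close>, so a bound shared by all of them on
      the \<open>d\<close>-neighbourhood improves to half of itself there.\<close>
    have "norm (f i \<tau>) \<le> B / 2 ^ k" if "\<bar>\<tau> - t\<bar> < d" for i \<tau> k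
      using that
    proof (induction k arbitrary: i \<tau>)
      case 0
      then show ?case using B d by auto
    next
      case (Suc k)
      have "norm (f i \<tau> - f i t) \<le> D * (B / 2 ^ k) * \<bar>\<tau> - t\<bar>"
      proof (rule norm_le_of_vector_derivative_bound[OF convex_ball[of t d] _ _ der])
        fix z assume "z \<in> ball t d"
        then have z: "\<bar>z - t\<bar> < d" by (simp add: dist_real_def abs_minus_commute)
        then have "norm (f' i z) \<le> C * (B / 2 ^ k)"
          using Suc.IH d by (intro C) auto
        also have "\<dots> \<le> D * (B / 2 ^ k)" using D B0 by (intro mult_right_mono) auto
        finally show "norm (f' i z) \<le> D * (B / 2 ^ k)" .
      qed (use Suc.prems d in \<open>auto simp: dist_real_def abs_minus_commute\<close>)
      also have "\<dots> \<le> D * (B / 2 ^ k) * d"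
        using Suc.prems D B0 by (intro mult_left_mono) auto
      also have "\<dots> = (D * d) * (B / 2 ^ k)" by simp
      also have "\<dots> \<le> 1 / 2 * (B / 2 ^ k)" using d B0 by (intro mult_right_mono) auto
      finally show ?case using t by (simp add: Z_def)
    qed
    moreover have "(\<lambda>k. B / 2 ^ k) \<longlonglongrightarrow> 0"
      using tendsto_mult_right_zero[OF LIMSEQ_inverse_realpow_zero[of 2], of B] by (simp add: divide_inverse)
    ultimately have "norm (f i \<tau>) \<le> 0" if "\<bar>\<tau> - t\<bar> < d" for i \<tau>
      using that by (intro LIMSEQ_le_const[of "\<lambda>k. B / 2 ^ k"]) auto
    then show "\<exists>e>0. \<forall>y. dist y t < e \<longrightarrow> y \<in> Z"
      using d by (intro exI[of _ d]) (auto simp: Z_def dist_real_def)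
  qed
  moreover have "t0 \<in> Z" using zero by (simp add: Z_def)
  ultimately have "Z = UNIV"
    using clopen[of Z] by auto
  then show ?thesis by (auto simp: Z_def)
qed

text \<open>
  The bounded functionals of the Lax pair.  In each convolution of the cubic term, either the
  second index is at least that of the column or the first index exceeds that of the row, so one
  factor is an entry of the Hankel matrix (\<open>convolution_split\<close>).
\<close>

definition conv_functional ::
    "(nat \<Rightarrow> complex) \<Rightarrow> (nat \<Rightarrow> nat set) \<Rightarrow> (nat \<Rightarrow> nat) \<Rightarrow> (nat \<Rightarrow> complex) \<Rightarrow> complex" where
  "conv_functional x I N f = (\<Sum>m. cnj (x m) * (\<Sum>i\<in>I m. x (N m - i) * f i))"

context
  fixes x :: "nat \<Rightarrow> complex" and I :: "nat \<Rightarrow> nat set" and N :: "nat \<Rightarrow> nat"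
  assumes x: "summable (\<lambda>n. norm (x n))" and I: "\<And>m. I m \<subseteq> {..N m}"
begin

text \<open>On \<open>I m\<close> the truncated subtraction \<open>N m - i\<close> is injective, so
  the weights form a subsum of the \<open>l^1\<close> norm of \<open>x\<close>. Only a uniform bound
  of \<open>f\<close> enters, as \<open>linear_family_zero\<close> requires.\<close>

lemma conv_functional_term_bound:
  assumes "\<And>i. norm (f i) \<le> b"
  shows "norm (cnj (x m) * (\<Sum>i\<in>I m. x (N m - i) * f i)) \<le> norm (x m) * ((\<Sum>n. norm (x n)) * b)"
proof -
  have "(\<Sum>i\<in>I m. norm (x (N m - i))) = (\<Sum>n\<in>(\<lambda>i. N m - i) ` I m. norm (x n))"
  proof (rule sum.reindex[symmetric, unfolded comp_def])
    show "inj_on (\<lambda>i. N m - i) (I m)"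
      using I[of m] by (intro inj_onI) (metis atMost_iff diff_diff_cancel subsetD)
  qed
  also have "\<dots> \<le> (\<Sum>n. norm (x n))"
    using I[of m] finite_subset by (intro sum_le_suminf x) auto
  finally have le: "(\<Sum>i\<in>I m. norm (x (N m - i))) \<le> (\<Sum>n. norm (x n))" .
  have b: "b \<ge> 0" using assms[of 0] by (meson norm_ge_zero order_trans)
  have "norm (\<Sum>i\<in>I m. x (N m - i) * f i) \<le> (\<Sum>i\<in>I m. norm (x (N m - i)) * b)"
    by (intro sum_norm_le) (simp add: norm_mult assms mult_left_mono)
  also have "\<dots> \<le> (\<Sum>n. norm (x n)) * b"
    unfolding sum_distrib_right[symmetric] using le b by (rule mult_right_mono)
  finally show ?thesis by (simp add: norm_mult mult_left_mono)
qed

lemma conv_functional_summable: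
  assumes "\<And>i. norm (f i) \<le> b"
  shows "summable (\<lambda>m. norm (cnj (x m) * (\<Sum>i\<in>I m. x (N m - i) * f i)))"
  by (rule summable_comparison_test[OF _ summable_mult2[OF x, of "(\<Sum>n. norm (x n)) * b"]])
    (use conv_functional_term_bound[of f b, OF assms] in auto)

lemma conv_functional_bound:
  assumes "\<And>i. norm (f i) \<le> b"
  shows "norm (conv_functional x I N f) \<le> (\<Sum>n. norm (x n))\<^sup>2 * b"
proof -
  note s = conv_functional_summable[of f b, OF assms]
  have "norm (conv_functional x I N f) \<le> (\<Sum>m. norm (cnj (x m) * (\<Sum>i\<in>I m. x (N m - i) * f i)))"
    unfolding conv_functional_def by (rule summable_norm[OF s])
  also have "\<dots> \<le> (\<Sum>m. norm (x m) * ((\<Sum>n. norm (x n)) * b))"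
    by (intro suminf_le s conv_functional_term_bound assms summable_mult2 x)
  also have "\<dots> = (\<Sum>n. norm (x n))\<^sup>2 * b"
    by (simp add: suminf_mult2[OF x, symmetric] power2_eq_square)
  finally show ?thesis .
qed

text \<open>The combination \<open>c * f - d * g\<close> is that of a 2 by 2 minor in which one row
  or column index is left free.\<close>

lemma conv_functional_linear:
  assumes f: "\<And>i. norm (f i) \<le> b" and g: "\<And>i. norm (g i) \<le> b'"
  shows "conv_functional x I N (\<lambda>i. c * f i - d * g i) = c * conv_functional x I N f - d * conv_functional x I N g"
proof -
  note sf = summable_norm_cancel[OF conv_functional_summable[of f b, OF f]]
  note sg = summable_norm_cancel[OF conv_functional_summable[of g b', OF g]]
  have "cnj (x m) * (\<Sum>i\<in>I m. x (N m - i) * (c * f i - d * g i)) =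
      c * (cnj (x m) * (\<Sum>i\<in>I m. x (N m - i) * f i)) - d * (cnj (x m) * (\<Sum>i\<in>I m. x (N m - i) * g i))" for m
    by (simp add: sum_distrib_left sum_subtractf[symmetric] algebra_simps)
  then show ?thesis
    unfolding conv_functional_def
    using suminf_diff[OF summable_mult[OF sf, of c] summable_mult[OF sg, of d]] suminf_mult[OF sf, of c] suminf_mult[OF sg, of d]
    by simp
qed

end

lemma convolution_split:
  fixes x :: "nat \<Rightarrow> complex"
  shows "(\<Sum>k\<le>j + l + m. x k * x (j + l + m - k)) =
    (\<Sum>i\<le>j + m. x (j + m - i) * x (i + l)) + (\<Sum>i\<in>{m<..m + l}. x (m + l - i) * x (j + i))"
proof -
  \<comment> \<open>The cut is at \<open>k = l\<close>. Above it \<open>k = i + l\<close>; below it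
    the other factor has index \<open>j + i\<close> with \<open>i = m + l - k > m\<close>.\<close>
  have "{..j + l + m} = {l..j + l + m} \<union> {..<l}" by auto
  then have "(\<Sum>k\<le>j + l + m. x k * x (j + l + m - k)) =
      (\<Sum>k\<in>{l..j + l + m}. x k * x (j + l + m - k)) + (\<Sum>k<l. x k * x (j + l + m - k))"
    by (simp only:) (intro sum.union_disjoint; auto)
  also have "(\<Sum>k\<in>{l..j + l + m}. x k * x (j + l + m - k)) = (\<Sum>i\<le>j + m. x (j + m - i) * x (i + l))"
    by (rule sum.reindex_bij_witness[of _ "\<lambda>i. i + l" "\<lambda>k. k - l"]) (auto simp: algebra_simps)
  also have "(\<Sum>k<l. x k * x (j + l + m - k)) = (\<Sum>i\<in>{m<..m + l}. x (m + l - i) * x (j + i))"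
    by (rule sum.reindex_bij_witness[of _ "\<lambda>i. m + l - i" "\<lambda>k. m + l - k"]) (auto simp: algebra_simps)
  finally show ?thesis .
qed

definition beta_conv_functional ::
    "real \<Rightarrow> (nat \<Rightarrow> complex) \<Rightarrow> (nat \<Rightarrow> nat set) \<Rightarrow> (nat \<Rightarrow> nat set) \<Rightarrow> (nat \<Rightarrow> nat) \<Rightarrow> (nat \<Rightarrow> complex) \<Rightarrow> complex" where
  "beta_conv_functional \<beta> x I I' N f =
     conv_functional x I N f - of_real \<beta> * conv_functional (\<lambda>n. x (Suc n)) I' N f"

definition hankel_left :: "real \<Rightarrow> (nat \<Rightarrow> complex) \<Rightarrow> nat \<Rightarrow> (nat \<Rightarrow> complex) \<Rightarrow> complex" where
  "hankel_left \<beta> x j = beta_conv_functional \<beta> x (\<lambda>m. {..j + m}) (\<lambda>m. {..j + m}) (\<lambda>m. j + m)"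

text \<open>The two ranges differ by the term \<open>i = m\<close>. The entry is
  \<open>x (Suc (j + i))\<close>: for \<open>x\<close> itself this is reached after lowering the
  index of the split by one, for the shifted sequence it appears directly.\<close>

definition hankel_right :: "real \<Rightarrow> (nat \<Rightarrow> complex) \<Rightarrow> nat \<Rightarrow> (nat \<Rightarrow> complex) \<Rightarrow> complex" where
  "hankel_right \<beta> x l = beta_conv_functional \<beta> x (\<lambda>m. {m..m + l}) (\<lambda>m. {m<..m + l}) (\<lambda>m. m + l)"

context
  fixes x :: "nat \<Rightarrow> complex"
  assumes x: "summable (\<lambda>n. norm (x n))"
begin

lemma summable_shifted: "summable (\<lambda>n. norm (x (Suc n)))"
  using x summable_Suc_iff[of "\<lambda>n. norm (x n)"] by simp

lemma beta_conv_functional_bound: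
  assumes I: "\<And>m. I m \<subseteq> {..N m}" "\<And>m. I' m \<subseteq> {..N m}" and f: "\<And>i. norm (f i) \<le> b"
  shows "norm (beta_conv_functional \<beta> x I I' N f) \<le> (1 + \<bar>\<beta>\<bar>) * (\<Sum>n. norm (x n))\<^sup>2 * b"
proof -
  let ?v = "\<lambda>n. x (Suc n)"
  note v = summable_shifted
  have vx: "(\<Sum>n. norm (?v n))\<^sup>2 \<le> (\<Sum>n. norm (x n))\<^sup>2"
    using suminf_split_head[OF x] by (intro power_mono suminf_nonneg v) auto
  have b: "b \<ge> 0" using f[of 0] by (meson norm_ge_zero order_trans)
  have "norm (beta_conv_functional \<beta> x I I' N f) \<le> norm (conv_functional x I N f) + \<bar>\<beta>\<bar> * norm (conv_functional ?v I' N f)"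
    unfolding beta_conv_functional_def by (rule order.trans[OF norm_triangle_ineq4]) (simp add: norm_mult)
  also have "\<dots> \<le> (\<Sum>n. norm (x n))\<^sup>2 * b + \<bar>\<beta>\<bar> * ((\<Sum>n. norm (?v n))\<^sup>2 * b)"
    by (intro add_mono mult_left_mono conv_functional_bound x v I f) auto
  also have "\<dots> \<le> (\<Sum>n. norm (x n))\<^sup>2 * b + \<bar>\<beta>\<bar> * ((\<Sum>n. norm (x n))\<^sup>2 * b)"
    by (intro add_mono mult_left_mono mult_right_mono vx b) auto
  finally show ?thesis by (simp add: algebra_simps)
qed

lemma beta_conv_functional_linear:
  assumes "\<And>m. I m \<subseteq> {..N m}" "\<And>m. I' m \<subseteq> {..N m}"
    and "\<And>i. norm (f i) \<le> b" "\<And>i. norm (g i) \<le> b'"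
  shows "beta_conv_functional \<beta> x I I' N (\<lambda>i. c * f i - d * g i) =
    c * beta_conv_functional \<beta> x I I' N f - d * beta_conv_functional \<beta> x I I' N g"
  unfolding beta_conv_functional_def
    conv_functional_linear[where f = f and b = b and g = g and b' = b' and I = I and N = N, OF x assms(1,3,4)]
    conv_functional_linear[where f = f and b = b and g = g and b' = b' and I = I' and N = N, OF summable_shifted assms(2,3,4)]
  by (simp add: algebra_simps)

lemma
  assumes "\<And>i. norm (f i) \<le> b"
  shows hankel_left_bound: "norm (hankel_left \<beta> x j f) \<le> (1 + \<bar>\<beta>\<bar>) * (\<Sum>n. norm (x n))\<^sup>2 * b"
    and hankel_right_bound: "norm (hankel_right \<beta> x j f) \<le> (1 + \<bar>\<beta>\<bar>) * (\<Sum>n. norm (x n))\<^sup>2 * b"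
  unfolding hankel_left_def hankel_right_def
  by (rule beta_conv_functional_bound; use assms in auto)+

lemma
  assumes "\<And>i. norm (f i) \<le> b" "\<And>i. norm (g i) \<le> b'"
  shows hankel_left_linear:
      "hankel_left \<beta> x j (\<lambda>i. c * f i - d * g i) = c * hankel_left \<beta> x j f - d * hankel_left \<beta> x j g"
    and hankel_right_linear:
      "hankel_right \<beta> x j (\<lambda>i. c * f i - d * g i) = c * hankel_right \<beta> x j f - d * hankel_right \<beta> x j g"
  unfolding hankel_left_def hankel_right_def
  by (rule beta_conv_functional_linear[OF _ _ assms]; auto)+

text \<open>The Lax pair entry by entry: the vector field on the Hankel matrix \<open>K\<close> has
  the form \<open>L K + K R\<close>. To expose entries of \<open>K\<close>, the convolution of
  \<open>x\<close> is split at \<open>Suc l\<close> and that of the shifted sequence at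
  \<open>l\<close>.\<close>

lemma beta_szego_field_hankel:
  "beta_szego_field \<beta> x (Suc (j + l)) =
     hankel_left \<beta> x j (\<lambda>i. x (Suc (i + l))) + hankel_right \<beta> x l (\<lambda>i. x (Suc (j + i)))"
proof -
  let ?v = "\<lambda>n. x (Suc n)"
  note v = summable_shifted
  let ?f = "\<lambda>i. x (Suc (i + l))" and ?g = "\<lambda>i. x (Suc (j + i))"
  have bd: "norm (x (h i)) \<le> (\<Sum>n. norm (x n))" for h :: "nat \<Rightarrow> nat" and i
    using sum_le_suminf[OF x, of "{h i}"] by simp
  have s1: "summable (\<lambda>m. cnj (x m) * (\<Sum>i\<in>{..j + m}. x (j + m - i) * ?f i))"
    by (rule summable_norm_cancel, rule conv_functional_summable[OF x, where N = "\<lambda>m. j + m"]) (auto intro: bd)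
  have s2: "summable (\<lambda>m. cnj (x m) * (\<Sum>i\<in>{m..m + l}. x (m + l - i) * ?g i))"
    by (rule summable_norm_cancel, rule conv_functional_summable[OF x, where N = "\<lambda>m. m + l"]) (auto intro: bd)
  have s3: "summable (\<lambda>m. cnj (?v m) * (\<Sum>i\<in>{..j + m}. ?v (j + m - i) * ?f i))"
    by (rule summable_norm_cancel, rule conv_functional_summable[OF v, where N = "\<lambda>m. j + m"]) (auto intro: bd)
  have s4: "summable (\<lambda>m. cnj (?v m) * (\<Sum>i\<in>{m<..m + l}. ?v (m + l - i) * ?g i))"
    by (rule summable_norm_cancel, rule conv_functional_summable[OF v, where N = "\<lambda>m. m + l"]) (auto intro: bd)
  have "(\<Sum>k\<le>Suc (j + l) + m. x k * x (Suc (j + l) + m - k)) =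
      (\<Sum>i\<le>j + m. x (j + m - i) * ?f i) + (\<Sum>i\<in>{m..m + l}. x (m + l - i) * ?g i)" for m
  proof -
    have "(\<Sum>i\<in>{m<..m + Suc l}. x (m + Suc l - i) * x (j + i)) = (\<Sum>i\<in>{m..m + l}. x (m + l - i) * ?g i)"
      by (rule sum.reindex_bij_witness[of _ Suc "\<lambda>i. i - 1"]) auto
    then show ?thesis
      using convolution_split[of x j "Suc l" m] by simp
  qed
  then have "cubic_coeff x (Suc (j + l)) = conv_functional x (\<lambda>m. {..j + m}) (\<lambda>m. j + m) ?f + conv_functional x (\<lambda>m. {m..m + l}) (\<lambda>m. m + l) ?g"
    unfolding cubic_coeff_def conv_functional_def suminf_add[OF s1 s2] by (simp only: distrib_left)
  moreover have "cubic_coeff ?v (j + l) = conv_functional ?v (\<lambda>m. {..j + m}) (\<lambda>m. j + m) ?f + conv_functional ?v (\<lambda>m. {m<..m + l}) (\<lambda>m. m + l) ?g"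
    unfolding cubic_coeff_def conv_functional_def suminf_add[OF s3 s4] convolution_split[of ?v]
    by (simp only: distrib_left)
  ultimately show ?thesis
    by (simp add: beta_szego_field_def hankel_left_def hankel_right_def beta_conv_functional_def algebra_simps)
qed

end

text \<open>All that the argument retains of the solution until the final Sobolev estimate.\<close>

locale beta_szego_flow =
  fixes \<beta> :: real and a :: "real \<Rightarrow> nat \<Rightarrow> complex"
  assumes summable_coeffs: "\<And>t. summable (\<lambda>n. norm (a t n))"
    and deriv_coeffs: "\<And>t n. ((\<lambda>\<tau>. a \<tau> n) has_vector_derivative - \<i> * beta_szego_field \<beta> (a t) n) (at t)"
    and locally_bounded_coeffs: "\<And>t. \<exists>A. eventually (\<lambda>\<tau>. (\<Sum>n. norm (a \<tau> n)) \<le> A) (at t)"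
begin

lemma coeff_le: "norm (a t n) \<le> (\<Sum>n. norm (a t n))"
  using sum_le_suminf[OF summable_coeffs[of t], of "{n}"] by simp

lemma local_bound:
  obtains e A where "e > 0" "A \<ge> 0" "\<And>\<tau>. \<bar>\<tau> - t\<bar> < e \<Longrightarrow> (\<Sum>n. norm (a \<tau> n)) \<le> A"
proof -
  obtain A where "eventually (\<lambda>\<tau>. (\<Sum>n. norm (a \<tau> n)) \<le> A) (at t)"
    using locally_bounded_coeffs by blast
  then obtain e where e: "e > 0" "\<And>\<tau>. \<tau> \<noteq> t \<Longrightarrow> \<bar>\<tau> - t\<bar> < e \<Longrightarrow> (\<Sum>n. norm (a \<tau> n)) \<le> A"
    unfolding eventually_at by (auto simp: dist_real_def)
  have nn: "(\<Sum>n. norm (a t n)) \<ge> 0" by (intro suminf_nonneg summable_coeffs) auto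
  show ?thesis
  proof (rule that[of e "max A (\<Sum>n. norm (a t n))"])
    show "(\<Sum>n. norm (a \<tau> n)) \<le> max A (\<Sum>n. norm (a t n))" if "\<bar>\<tau> - t\<bar> < e" for \<tau>
      using e(2)[of \<tau>] that by (cases "\<tau> = t") auto
  qed (use e nn in auto)
qed

text \<open>By the Lax pair with \<open>l = 0\<close>, the derivative of every nonconstant
  coefficient is linear in the nonconstant coefficients. The reference time \<open>t0\<close> is
  free, so the lemma also runs backwards.\<close>

lemma nonconstant_coeffs_zero:
  assumes "\<And>n. a t0 (Suc n) = 0"
  shows "a t (Suc n) = 0"
proof (rule linear_family_zero[where f = "\<lambda>n t. a t (Suc n)", OF deriv_coeffs _ assms])
  fix t
  obtain e A where e: "e > 0" "A \<ge> 0" "\<And>\<tau>. \<bar>\<tau> - t\<bar> < e \<Longrightarrow> (\<Sum>n. norm (a \<tau> n)) \<le> A"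
    using local_bound by blast
  let ?C = "2 * ((1 + \<bar>\<beta>\<bar>) * A\<^sup>2)"
  have "norm (a \<tau> (Suc n)) \<le> A" if "\<bar>\<tau> - t\<bar> < e" for \<tau> n
    using coeff_le[of \<tau> "Suc n"] e(3)[OF that] by simp
  moreover have "norm (- \<i> * beta_szego_field \<beta> (a \<tau>) (Suc n)) \<le> ?C * b"
    if \<tau>: "\<bar>\<tau> - t\<bar> < e" and b: "\<And>n. norm (a \<tau> (Suc n)) \<le> b" for \<tau> b n
  proof -
    have b0: "b \<ge> 0" using b[of 0] by (meson norm_ge_zero order_trans)
    let ?C' = "(1 + \<bar>\<beta>\<bar>) * (\<Sum>n. norm (a \<tau> n))\<^sup>2"
    have C': "?C' * b \<le> ((1 + \<bar>\<beta>\<bar>) * A\<^sup>2) * b"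
      using e(3)[OF \<tau>] b0 by (intro mult_right_mono mult_left_mono power_mono suminf_nonneg summable_coeffs) auto
    have "norm (beta_szego_field \<beta> (a \<tau>) (Suc n)) \<le> ?C' * b + ?C' * b"
      unfolding beta_szego_field_hankel[OF summable_coeffs, of \<beta> \<tau> n 0, unfolded add_0_right]
      by (intro norm_triangle_mono hankel_left_bound hankel_right_bound summable_coeffs) (simp_all add: b)
    then have "norm (- \<i> * beta_szego_field \<beta> (a \<tau>) (Suc n)) \<le> ?C' * b + ?C' * b"
      by (simp only: norm_mult norm_minus_cancel norm_ii mult_1)
    also have "\<dots> \<le> ((1 + \<bar>\<beta>\<bar>) * A\<^sup>2) * b + ((1 + \<bar>\<beta>\<bar>) * A\<^sup>2) * b"
      by (intro add_mono C')
    finally show ?thesis by (simp add: algebra_simps)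
  qed
  ultimately show "\<exists>e>0. \<exists>B C. \<forall>\<tau>. \<bar>\<tau> - t\<bar> < e \<longrightarrow> (\<forall>n. norm (a \<tau> (Suc n)) \<le> B) \<and>
      (\<forall>b. (\<forall>n. norm (a \<tau> (Suc n)) \<le> b) \<longrightarrow> (\<forall>n. norm (- \<i> * beta_szego_field \<beta> (a \<tau>) (Suc n)) \<le> C * b))"
    using e(1) by (intro exI[of _ e] conjI exI[of _ A] exI[of _ ?C]) auto
qed

text \<open>By linearity of the functionals, differentiating a minor replaces one of its four
  indices by the summation index; the derivative is thus a sum of four bounded functionals of
  minors, whence the factor 4 in \<open>?C\<close>. The family is indexed by all quadruples at
  once.\<close>

lemma hankel_minors_zero:
  assumes "\<And>j k l m. a t0 (Suc (j + l)) * a t0 (Suc (k + m)) = a t0 (Suc (j + m)) * a t0 (Suc (k + l))"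
  shows "a t (Suc (j + l)) * a t (Suc (k + m)) = a t (Suc (j + m)) * a t (Suc (k + l))"
proof -
  define D where "D = (\<lambda>(j,k,l,m) t. a t (Suc (j + l)) * a t (Suc (k + m)) - a t (Suc (j + m)) * a t (Suc (k + l)))"
  define F where "F t n = beta_szego_field \<beta> (a t) n" for t n
  define D' where "D' = (\<lambda>(j,k,l,m) t. - \<i> *
    (F t (Suc (j + l)) * a t (Suc (k + m)) + a t (Suc (j + l)) * F t (Suc (k + m))
     - F t (Suc (j + m)) * a t (Suc (k + l)) - a t (Suc (j + m)) * F t (Suc (k + l))))"
  have "D (j,k,l,m) t = 0"
  proof (rule linear_family_zero[where f' = D'])
    fix i :: "nat \<times> nat \<times> nat \<times> nat" and t
    obtain j k l m where i: "i = (j,k,l,m)" by (cases i)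
    show "(D i has_vector_derivative D' i t) (at t)"
      unfolding i D_def D'_def F_def prod.case
      by (auto intro!: derivative_eq_intros has_vector_derivative_mult deriv_coeffs simp: algebra_simps)
    show "D i t0 = 0"
      using assms[of j l k m] by (simp add: i D_def)
  next
    fix t
    obtain e A where e: "e > 0" "A \<ge> 0" "\<And>\<tau>. \<bar>\<tau> - t\<bar> < e \<Longrightarrow> (\<Sum>n. norm (a \<tau> n)) \<le> A"
      using local_bound by blast
    let ?C = "4 * ((1 + \<bar>\<beta>\<bar>) * A\<^sup>2)"
    have bd: "norm (a \<tau> n) \<le> A" if "\<bar>\<tau> - t\<bar> < e" for \<tau> n
      using coeff_le[of \<tau> "n"] e(3)[OF that] by simp
    have "norm (D i \<tau>) \<le> 2 * A\<^sup>2" if "\<bar>\<tau> - t\<bar> < e" for \<tau> i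
    proof -
      obtain j k l m where i: "i = (j,k,l,m)" by (cases i)
      have "norm (D i \<tau>) \<le> A * A + A * A"
        unfolding D_def i prod.case
        by (rule order.trans[OF norm_triangle_ineq4], unfold norm_mult)
          (intro add_mono mult_mono bd that e(2) norm_ge_zero)
      then show ?thesis by (simp add: power2_eq_square)
    qed
    moreover have "norm (D' i \<tau>) \<le> ?C * b"
      if \<tau>: "\<bar>\<tau> - t\<bar> < e" and b: "\<And>i. norm (D i \<tau>) \<le> b" for \<tau> b i
    proof -
      obtain j k l m where i: "i = (j,k,l,m)" by (cases i)
      have b0: "b \<ge> 0" using b[of i] by (meson norm_ge_zero order_trans)
      let ?C' = "(1 + \<bar>\<beta>\<bar>) * (\<Sum>n. norm (a \<tau> n))\<^sup>2"
      let ?K = "\<lambda>j l. a \<tau> (Suc (j + l))"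
      let ?L = "hankel_left \<beta> (a \<tau>)" and ?R = "hankel_right \<beta> (a \<tau>)"
      have C': "?C' * b \<le> ((1 + \<bar>\<beta>\<bar>) * A\<^sup>2) * b"
        using e(3)[OF \<tau>] b0 by (intro mult_right_mono mult_left_mono power_mono suminf_nonneg summable_coeffs) auto
      note bd' = bd[OF \<tau>]
      have lin: "?L j (\<lambda>i. c * a \<tau> (f i) - d * a \<tau> (g i)) = c * ?L j (\<lambda>i. a \<tau> (f i)) - d * ?L j (\<lambda>i. a \<tau> (g i))"
        "?R j (\<lambda>i. c * a \<tau> (f i) - d * a \<tau> (g i)) = c * ?R j (\<lambda>i. a \<tau> (f i)) - d * ?R j (\<lambda>i. a \<tau> (g i))"
        for j f g c d
        by (rule hankel_left_linear hankel_right_linear; rule summable_coeffs bd')+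
      \<comment> \<open>The eight terms of the derivative, grouped by functional. Each argument is,
        up to the order of its factors, a minor with a free index.\<close>
      have eq: "D' i \<tau> = - \<i> *
         (?L j (\<lambda>i. ?K k m * ?K i l - ?K k l * ?K i m) + ?L k (\<lambda>i. ?K j l * ?K i m - ?K j m * ?K i l)
        + (?R l (\<lambda>i. ?K k m * ?K j i - ?K j m * ?K k i) + ?R m (\<lambda>i. ?K j l * ?K k i - ?K k l * ?K j i)))"
        unfolding D'_def i prod.case F_def lin beta_szego_field_hankel[OF summable_coeffs] by (simp add: algebra_simps)
      have n1: "norm (D' i \<tau>) \<le> (?C' * b + ?C' * b) + (?C' * b + ?C' * b)"
        unfolding eq norm_mult norm_minus_cancel norm_ii mult_1
      proof (intro norm_triangle_mono hankel_left_bound hankel_right_bound summable_coeffs)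
        fix n
        show "norm (?K k m * ?K n l - ?K k l * ?K n m) \<le> b" using b[of "(n,k,l,m)"] by (simp add: D_def mult.commute)
        show "norm (?K j l * ?K n m - ?K j m * ?K n l) \<le> b" using b[of "(j,n,l,m)"] by (simp add: D_def mult.commute)
        show "norm (?K k m * ?K j n - ?K j m * ?K k n) \<le> b" using b[of "(j,k,n,m)"] by (simp add: D_def mult.commute)
        show "norm (?K j l * ?K k n - ?K k l * ?K j n) \<le> b" using b[of "(j,k,l,n)"] by (simp add: D_def mult.commute)
      qed
      have n2: "(?C' * b + ?C' * b) + (?C' * b + ?C' * b) \<le> (((1 + \<bar>\<beta>\<bar>) * A\<^sup>2) * b + ((1 + \<bar>\<beta>\<bar>) * A\<^sup>2) * b) + (((1 + \<bar>\<beta>\<bar>) * A\<^sup>2) * b + ((1 + \<bar>\<beta>\<bar>) * A\<^sup>2) * b)"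
        by (intro add_mono C')
      from order.trans[OF n1 n2] show ?thesis by (simp add: algebra_simps)
    qed
    ultimately show "\<exists>e>0. \<exists>B C. \<forall>\<tau>. \<bar>\<tau> - t\<bar> < e \<longrightarrow> (\<forall>i. norm (D i \<tau>) \<le> B) \<and>
        (\<forall>b. (\<forall>i. norm (D i \<tau>) \<le> b) \<longrightarrow> (\<forall>i. norm (D' i \<tau>) \<le> C * b))"
      using e(1) by (intro exI[of _ e] conjI exI[of _ "2 * A\<^sup>2"] exI[of _ ?C]) auto
  qed
  then show ?thesis by (simp add: D_def)
qed

end

section \<open>Conservation laws on the rational manifold\<close>

lemma one_minus_p_cnj_p:
  assumes "norm p < 1"
  shows "norm (p * cnj p) < 1" "1 - p * cnj p \<noteq> 0"
proof -
  have "norm p * norm p < 1 * 1" using assms by (intro mult_strict_mono') auto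
  then show *: "norm (p * cnj p) < 1" by (simp add: norm_mult)
  show "1 - p * cnj p \<noteq> 0"
  proof
    assume "1 - p * cnj p = 0"
    then have "p * cnj p = 1" by simp
    with * show False by simp
  qed
qed

text \<open>With \<open>r = p * cnj p\<close>, the second sum splits \<open>Suc (n + m)\<close> into
  \<open>n\<close> and \<open>Suc m\<close>: a geometric series and its derivative, giving
  \<open>n / y\<close> and \<open>1 / y^2\<close>.\<close>

lemma geometric_weighted_sums:
  fixes c d p :: complex
  assumes p: "norm p < 1"
  defines "y \<equiv> 1 - p * cnj p"
  shows "(\<lambda>m. cnj c * cnj p ^ m * (d * p ^ (n + m))) sums (cnj c * d * p ^ n / y)"
    and "(\<lambda>m. cnj c * cnj p ^ m * (of_nat (Suc (n + m)) * d * p ^ (n + m))) sums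
      (cnj c * d * p ^ n * (of_nat n / y + 1 / y\<^sup>2))"
proof -
  note r = one_minus_p_cnj_p(1)[OF p]
  show A: "(\<lambda>m. cnj c * cnj p ^ m * (d * p ^ (n + m))) sums (cnj c * d * p ^ n / y)"
    using sums_mult[OF geometric_sums[OF r], of "cnj c * d * p ^ n"]
    by (simp add: y_def power_add power_mult_distrib mult_ac)
  have "(\<lambda>m. cnj c * d * p ^ n * (of_nat (Suc m) * (p * cnj p) ^ m)) sums (cnj c * d * p ^ n * (1 / y\<^sup>2))"
    unfolding y_def by (intro sums_mult geometric_deriv_sums r)
  from sums_add[OF this sums_mult[OF A, of "of_nat n"]]
  show "(\<lambda>m. cnj c * cnj p ^ m * (of_nat (Suc (n + m)) * d * p ^ (n + m))) sums
      (cnj c * d * p ^ n * (of_nat n / y + 1 / y\<^sup>2))"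
    by (simp add: power_add power_mult_distrib algebra_simps)
qed

lemma cubic_coeff_geometric:
  fixes c p :: complex
  assumes p: "norm p < 1"
  defines "y \<equiv> 1 - p * cnj p"
  shows "cubic_coeff (\<lambda>n. c * p ^ n) n = cnj c * c\<^sup>2 * p ^ n * (of_nat n / y + 1 / y\<^sup>2)"
proof -
  have "(\<Sum>k\<le>j. c * p ^ k * (c * p ^ (j - k))) = of_nat (Suc j) * c\<^sup>2 * p ^ j" for j
  proof -
    have "(\<Sum>k\<le>j. c * p ^ k * (c * p ^ (j - k))) = (\<Sum>k\<le>j. c\<^sup>2 * p ^ j)"
      by (rule sum.cong) (auto simp: power2_eq_square power_add[symmetric] mult_ac)
    then show ?thesis by simp
  qed
  then have "cubic_coeff (\<lambda>n. c * p ^ n) n = (\<Sum>m. cnj c * cnj p ^ m * (of_nat (Suc (n + m)) * c\<^sup>2 * p ^ (n + m)))"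
    by (simp add: cubic_coeff_def del: of_nat_Suc)
  also have "\<dots> = cnj c * c\<^sup>2 * p ^ n * (of_nat n / y + 1 / y\<^sup>2)"
    unfolding y_def by (rule sums_unique[symmetric, OF geometric_weighted_sums(2)[OF p]])
  finally show ?thesis .
qed

text \<open>Three modes suffice, as \<open>b\<close>, \<open>c\<close> and \<open>p\<close> are
  recovered from \<open>x 0\<close>, \<open>x 1\<close> and \<open>x 2 / x 1\<close>.\<close>

lemma beta_szego_field_rational:
  fixes x :: "nat \<Rightarrow> complex"
  assumes p: "norm p < 1" and x: "\<And>n. x (Suc n) = c * p ^ n"
  defines "b \<equiv> x 0" and "y \<equiv> 1 - p * cnj p"
  shows "beta_szego_field \<beta> x 0 = cnj b * b\<^sup>2 + 2 * b * c * cnj c / y + cnj c * c\<^sup>2 * cnj p / y\<^sup>2"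
    and "beta_szego_field \<beta> x 1 = 2 * b * cnj b * c + 2 * b * c * cnj c * p / y + (1 - of_real \<beta>) * cnj c * c\<^sup>2 / y\<^sup>2"
    and "beta_szego_field \<beta> x 2 = cnj b * (2 * b * c * p + c\<^sup>2) + 2 * b * c * cnj c * p\<^sup>2 / y
      + (1 - of_real \<beta>) * cnj c * c\<^sup>2 * p * (1 / y + 1 / y\<^sup>2)"
proof -
  \<comment> \<open>The two end terms contain \<open>b\<close>, the \<open>j\<close> inner ones are
    all equal. For \<open>j = 0\<close> the factor \<open>of_nat j\<close> kills the truncated
    exponent.\<close>
  have sq: "(\<Sum>k\<le>Suc j. x k * x (Suc j - k)) = 2 * b * c * p ^ j + of_nat j * c\<^sup>2 * p ^ (j - 1)" for j
  proof -
    have "(\<Sum>k\<le>Suc j. x k * x (Suc j - k)) = b * (c * p ^ j) + (\<Sum>k\<le>j. x (Suc k) * x (j - k))"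
      by (subst sum.atMost_Suc_shift) (simp add: b_def x)
    also have "(\<Sum>k\<le>j. x (Suc k) * x (j - k)) = (\<Sum>k<j. x (Suc k) * x (j - k)) + c * p ^ j * b"
      by (simp add: lessThan_Suc_atMost[symmetric] b_def x)
    also have "(\<Sum>k<j. x (Suc k) * x (j - k)) = (\<Sum>k<j. c\<^sup>2 * p ^ (j - 1))"
    proof (rule sum.cong)
      fix k assume "k \<in> {..<j}"
      then obtain i where "j = Suc (k + i)" using less_imp_Suc_add by auto
      then show "x (Suc k) * x (j - k) = c\<^sup>2 * p ^ (j - 1)"
        by (simp add: x Suc_diff_le power_add power2_eq_square)
    qed simp
    finally show ?thesis by (simp add: algebra_simps)
  qed
  have geo: "(\<lambda>m. cnj c * cnj p ^ m * (2 * b * c * p ^ (n + m))) sums (cnj c * (2 * b * c) * p ^ n / y)" for n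
    unfolding y_def by (rule geometric_weighted_sums(1)[OF p])
  \<comment> \<open>The term \<open>m = 0\<close> is taken out because \<open>x 0\<close> does not
    belong to the geometric sequence.\<close>
  have split: "cubic_coeff x n = cnj b * (\<Sum>k\<le>n. x k * x (n - k)) + S"
    if "(\<lambda>m. cnj c * cnj p ^ m * (2 * b * c * p ^ (n + m) + of_nat (n + m) * c\<^sup>2 * p ^ (n + m - 1))) sums S" for n S
  proof -
    have "(\<lambda>m. cnj (x (Suc m)) * (\<Sum>k\<le>n + Suc m. x k * x (n + Suc m - k))) sums S"
      using that by (simp only: add_Suc_right sq x complex_cnj_mult complex_cnj_power)
    from sums_Suc[OF this] show ?thesis
      by (simp add: cubic_coeff_def sums_iff b_def add.commute)
  qed

  have "(\<lambda>m. cnj c * cnj p ^ m * (of_nat m * c\<^sup>2 * p ^ (m - 1))) sums (cnj c * c\<^sup>2 * cnj p / y\<^sup>2)"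
  proof -
    have "(\<lambda>m. cnj p * (cnj c * cnj p ^ m * (of_nat (Suc (0 + m)) * c\<^sup>2 * p ^ (0 + m)))) sums (cnj p * (cnj c * c\<^sup>2 * p ^ 0 * (of_nat 0 / y + 1 / y\<^sup>2)))"
      unfolding y_def by (intro sums_mult geometric_weighted_sums(2)[OF p])
    then have "(\<lambda>m. cnj c * cnj p ^ Suc m * (of_nat (Suc m) * c\<^sup>2 * p ^ (Suc m - 1))) sums (cnj c * c\<^sup>2 * cnj p / y\<^sup>2)"
      by (simp add: mult_ac del: of_nat_Suc)
    from sums_Suc[OF this] show ?thesis by simp
  qed
  from split[of 0, unfolded add_0_left, OF sums_add[OF geo[of 0, unfolded add_0_left] this, folded distrib_left]]
  show "beta_szego_field \<beta> x 0 = cnj b * b\<^sup>2 + 2 * b * c * cnj c / y + cnj c * c\<^sup>2 * cnj p / y\<^sup>2"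
    by (simp add: beta_szego_field_def b_def power2_eq_square mult_ac)

  \<comment> \<open>The part of the cubic term free of \<open>b\<close> coincides with mode
    \<open>n\<close> of the cubic term of the shifted sequence, hence the factor
    \<open>1 - \<beta>\<close>.\<close>
  have F: "beta_szego_field \<beta> x (Suc n) = cnj b * (2 * b * c * p ^ n + of_nat n * c\<^sup>2 * p ^ (n - 1)) + cnj c * (2 * b * c) * p ^ Suc n / y
      + (1 - of_real \<beta>) * (cnj c * c\<^sup>2 * p ^ n * (of_nat n / y + 1 / y\<^sup>2))" for n
  proof -
    have "(\<lambda>m. cnj c * cnj p ^ m * (of_nat (Suc n + m) * c\<^sup>2 * p ^ (Suc n + m - 1))) sums
        (cnj c * c\<^sup>2 * p ^ n * (of_nat n / y + 1 / y\<^sup>2))"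
      using geometric_weighted_sums(2)[OF p, where c = c and d = "c\<^sup>2" and n = n] by (simp add: y_def)
    from split[of "Suc n", OF sums_add[OF geo[of "Suc n"] this, folded distrib_left]]
    have "cubic_coeff x (Suc n) = cnj b * (2 * b * c * p ^ n + of_nat n * c\<^sup>2 * p ^ (n - 1)) + (cnj c * (2 * b * c) * p ^ Suc n / y
      + cnj c * c\<^sup>2 * p ^ n * (of_nat n / y + 1 / y\<^sup>2))"
      unfolding sq .
    moreover have "cubic_coeff (\<lambda>k. x (Suc k)) n = cnj c * c\<^sup>2 * p ^ n * (of_nat n / y + 1 / y\<^sup>2)"
      unfolding x y_def by (rule cubic_coeff_geometric[OF p])
    ultimately show ?thesis
      by (simp add: beta_szego_field_def algebra_simps diff_divide_distrib)
  qed
  show "beta_szego_field \<beta> x 1 = 2 * b * cnj b * c + 2 * b * c * cnj c * p / y + (1 - of_real \<beta>) * cnj c * c\<^sup>2 / y\<^sup>2"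
    using F[of 0] by (simp add: mult_ac)
  show "beta_szego_field \<beta> x 2 = cnj b * (2 * b * c * p + c\<^sup>2) + 2 * b * c * cnj c * p\<^sup>2 / y
      + (1 - of_real \<beta>) * cnj c * c\<^sup>2 * p * (1 / y + 1 / y\<^sup>2)"
    using F[of 1] by (simp add: numeral_2_eq_2 power2_eq_square mult_ac)
qed

lemma has_vector_derivative_quotient:
  fixes f g :: "real \<Rightarrow> complex"
  assumes "(f has_vector_derivative f') (at t)" "(g has_vector_derivative g') (at t)" "g t \<noteq> 0"
  shows "((\<lambda>t. f t / g t) has_vector_derivative (f' * g t - f t * g') / (g t)\<^sup>2) (at t)"
proof -
  have "((\<lambda>t. f t / g t) has_derivative
      (\<lambda>h. - f t * (inverse (g t) * (h *\<^sub>R g') * inverse (g t)) + (h *\<^sub>R f') / g t)) (at t)"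
    using assms unfolding has_vector_derivative_def by (intro has_derivative_divide) auto
  moreover have "(\<lambda>h. - f t * (inverse (g t) * (h *\<^sub>R g') * inverse (g t)) + (h *\<^sub>R f') / g t) =
      (\<lambda>h. h *\<^sub>R ((f' * g t - f t * g') / (g t)\<^sup>2))"
    using assms(3) by (auto simp: fun_eq_iff scaleR_conv_of_real field_simps power2_eq_square)
  ultimately show ?thesis by (simp add: has_vector_derivative_def)
qed

lemma constant_of_zero_vector_derivative:
  fixes f :: "real \<Rightarrow> complex"
  assumes "\<And>t. (f has_vector_derivative 0) (at t)"
  shows "f t = f 0"
  using has_vector_derivative_zero_constant[of UNIV f] assms by (metis UNIV_I convex_UNIV has_vector_derivative_at_within)

locale beta_szego_rational =
  fixes \<beta> :: real and b c p :: "real \<Rightarrow> complex"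
  assumes p_less: "\<And>t. norm (p t) < 1"
    and c_nonzero: "\<And>t. c t \<noteq> 0"
    and b_deriv: "\<And>t. (b has_vector_derivative - \<i> * (cnj (b t) * (b t)\<^sup>2 + 2 * b t * c t * cnj (c t) / (1 - p t * cnj (p t))
      + cnj (c t) * (c t)\<^sup>2 * cnj (p t) / (1 - p t * cnj (p t))\<^sup>2)) (at t)"
    and c_deriv: "\<And>t. (c has_vector_derivative - \<i> * (2 * b t * cnj (b t) * c t + 2 * b t * c t * cnj (c t) * p t / (1 - p t * cnj (p t))
      + (1 - of_real \<beta>) * cnj (c t) * (c t)\<^sup>2 / (1 - p t * cnj (p t))\<^sup>2)) (at t)"
    and p_deriv: "\<And>t. (p has_vector_derivative - \<i> * (cnj (b t) * c t + (1 - of_real \<beta>) * c t * cnj (c t) * p t / (1 - p t * cnj (p t)))) (at t)"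
begin

text \<open>All of these but \<open>z\<close> are real; they are kept complex-valued to
  differentiate products with conjugates. \<open>p_bounded_away\<close> returns to real
  numbers.\<close>

definition y :: "real \<Rightarrow> complex" where "y t = 1 - p t * cnj (p t)"
definition z :: "real \<Rightarrow> complex" where "z t = cnj (b t) * c t * cnj (p t)"
text \<open>The momentum, that is the sum of \<open>n * |a_n|^2\<close>, for the function
  \<open>b + c z / (1 - p z)\<close>.\<close>

definition Mc :: "real \<Rightarrow> complex" where "Mc t = c t * cnj (c t) / (y t * y t)"
text \<open>The mass, that is the squared \<open>L2\<close> norm.\<close>

definition Nc :: "real \<Rightarrow> complex" where "Nc t = b t * cnj (b t) + c t * cnj (c t) / y t"
text \<open>The energy in disguise: the fourth power of the \<open>L4\<close> norm of
  \<open>u\<close> minus \<beta> times that of \<open>S^dagger u\<close> equals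
  \<open>N^2 + M * E\<close>. Mass and momentum are frozen at time 0, so that only \<open>y\<close>
  and \<open>z\<close> vary.\<close>

definition Ec :: "real \<Rightarrow> complex" where
  "Ec t = 2 * Nc 0 * y t - 3 * Mc 0 * (y t * y t) + (1 - of_real \<beta>) * Mc 0 * (2 * y t - y t * y t) + 2 * (z t + cnj (z t))"

lemma y_nonzero: "y t \<noteq> 0"
  using one_minus_p_cnj_p(2)[OF p_less] by (simp add: y_def)

lemma cnj_y [simp]: "cnj (y t) = y t"
  by (simp add: y_def mult.commute)

text \<open>The \<beta>-dependent part of the derivative of \<open>p\<close>, times
  \<open>cnj p\<close>, is \<i> times a real number and drops out of the derivative of
  \<open>p * cnj p\<close>.\<close>

lemma y_deriv: "(y has_vector_derivative \<i> * (z t - cnj (z t))) (at t)"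
proof -
  have "(y has_vector_derivative 0 - (p t * cnj (- \<i> * (cnj (b t) * c t + (1 - of_real \<beta>) * c t * cnj (c t) * p t / y t))
     + - \<i> * (cnj (b t) * c t + (1 - of_real \<beta>) * c t * cnj (c t) * p t / y t) * cnj (p t))) (at t)"
    unfolding y_def[abs_def]
    by (intro has_vector_derivative_diff has_vector_derivative_const has_vector_derivative_mult has_vector_derivative_cnj p_deriv)
  then show ?thesis
    by (rule has_vector_derivative_eq_rhs) (simp add: z_def field_simps y_nonzero)
qed

text \<open>The right side is \<open>2 * |c|^2 * y' / y\<close>, so \<open>|c|^2\<close> evolves
  like \<open>y^2\<close>.\<close>

lemma c_sq_deriv: "((\<lambda>t. c t * cnj (c t)) has_vector_derivative 2 * \<i> * (c t * cnj (c t)) * (z t - cnj (z t)) / y t) (at t)"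
proof -
  let ?c' = "- \<i> * (2 * b t * cnj (b t) * c t + 2 * b t * c t * cnj (c t) * p t / y t + (1 - of_real \<beta>) * cnj (c t) * (c t)\<^sup>2 / (y t)\<^sup>2)"
  have "((\<lambda>t. c t * cnj (c t)) has_vector_derivative c t * cnj ?c' + ?c' * cnj (c t)) (at t)"
    unfolding y_def by (intro has_vector_derivative_mult has_vector_derivative_cnj c_deriv)
  then show ?thesis
    by (rule has_vector_derivative_eq_rhs) (simp add: z_def field_simps y_nonzero power2_eq_square)
qed

text \<open>The right side is \<open>- M * y'\<close> with \<open>M = |c|^2 / y^2\<close>, which
  compensates the change of \<open>M * y\<close> in the mass.\<close>

lemma b_sq_deriv: "((\<lambda>t. b t * cnj (b t)) has_vector_derivative - \<i> * (c t * cnj (c t)) / (y t * y t) * (z t - cnj (z t))) (at t)"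
proof -
  let ?b' = "- \<i> * (cnj (b t) * (b t)\<^sup>2 + 2 * b t * c t * cnj (c t) / y t + cnj (c t) * (c t)\<^sup>2 * cnj (p t) / (y t)\<^sup>2)"
  have "((\<lambda>t. b t * cnj (b t)) has_vector_derivative b t * cnj ?b' + ?b' * cnj (b t)) (at t)"
    unfolding y_def by (intro has_vector_derivative_mult has_vector_derivative_cnj b_deriv)
  then show ?thesis
    by (rule has_vector_derivative_eq_rhs) (simp add: z_def field_simps y_nonzero power2_eq_square)
qed

lemma Mc_const: "Mc t = Mc 0"
proof (rule constant_of_zero_vector_derivative)
  fix t
  show "(Mc has_vector_derivative 0) (at t)"
    unfolding Mc_def[abs_def]
    by (rule has_vector_derivative_eq_rhs[OF has_vector_derivative_quotient[OF c_sq_deriv has_vector_derivative_mult[OF y_deriv y_deriv]]])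
      (simp_all add: y_nonzero field_simps)
qed

lemma Nc_const: "Nc t = Nc 0"
proof (rule constant_of_zero_vector_derivative)
  fix t
  show "(Nc has_vector_derivative 0) (at t)"
    unfolding Nc_def[abs_def]
    by (rule has_vector_derivative_eq_rhs[OF has_vector_derivative_add[OF b_sq_deriv has_vector_derivative_quotient[OF c_sq_deriv y_deriv]]])
      (simp_all add: y_nonzero field_simps power2_eq_square)
qed

lemma Ec_const: "Ec t = Ec 0"
proof (rule constant_of_zero_vector_derivative)
  fix t
  define B C P Y where "B = b t" "C = c t" "P = p t" "Y = y t"
  note defs = this
  have Y: "Y \<noteq> 0" "cnj Y = Y" using y_nonzero by (simp_all add: defs)
  have PP: "P * cnj P = 1 - Y" by (simp add: defs y_def)
  define b' where "b' = - \<i> * (cnj B * B\<^sup>2 + 2 * B * C * cnj C / Y + cnj C * C\<^sup>2 * cnj P / Y\<^sup>2)"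
  define c' where "c' = - \<i> * (2 * B * cnj B * C + 2 * B * C * cnj C * P / Y + (1 - of_real \<beta>) * cnj C * C\<^sup>2 / Y\<^sup>2)"
  define p' where "p' = - \<i> * (cnj B * C + (1 - of_real \<beta>) * C * cnj C * P / Y)"
  define z' where "z' = (cnj B * C) * cnj p' + (cnj B * c' + cnj b' * C) * cnj P"
  have zd: "(z has_vector_derivative z') (at t)"
    unfolding z_def[abs_def] z'_def b'_def c'_def p'_def defs y_def
    by (intro has_vector_derivative_mult has_vector_derivative_cnj b_deriv c_deriv p_deriv)
  have NM: "2 * Nc 0 = 2 * (B * cnj B + C * cnj C / Y)" "Mc 0 = C * cnj C / (Y * Y)"
    using Nc_const[of t] Mc_const[of t] by (simp_all add: Nc_def Mc_def defs)
  define Z where "Z = cnj B * C * cnj P"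
  then have Zt: "z t = Z" by (simp add: z_def defs)
  \<comment> \<open>Once \<open>z'\<close> is written through \<open>Z\<close>, squared moduli and
    \<open>P * cnj P\<close>, the terms of the form \<i> times a real number cancel and only
    multiples of \<open>Z - cnj Z\<close> survive.\<close>
  have z': "z' + cnj z' = - \<i> * (Z - cnj Z) * (B * cnj B - 2 * (C * cnj C) / Y + (1 - of_real \<beta>) * (C * cnj C) / (Y * Y) * (1 - Y))"
  proof -
    have zz: "z' = \<i> * ((cnj B * B) * Z + 2 * (C * cnj C) / Y * Z + (C * cnj C)\<^sup>2 / Y\<^sup>2 * (P * cnj P)
        - (2 * B * cnj B * Z + 2 * (B * cnj B) * (C * cnj C) * (P * cnj P) / Y + (1 - of_real \<beta>) * (C * cnj C) / Y\<^sup>2 * Z)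
        + ((B * cnj B) * (C * cnj C) + (1 - of_real \<beta>) * (C * cnj C) / Y * Z))"
      using Y by (simp add: z'_def b'_def c'_def p'_def Z_def field_simps power2_eq_square)
    show ?thesis
      unfolding zz PP using Y by (simp add: field_simps power2_eq_square)
  qed
  let ?Y' = "\<i> * (Z - cnj Z)"
  have "(Ec has_vector_derivative 2 * Nc 0 * ?Y' - 3 * Mc 0 * (y t * ?Y' + ?Y' * y t)
      + (1 - of_real \<beta>) * Mc 0 * (2 * ?Y' - (y t * ?Y' + ?Y' * y t)) + 2 * (z' + cnj z')) (at t)"
    unfolding Ec_def[abs_def]
    by (intro has_vector_derivative_add has_vector_derivative_diff has_vector_derivative_mult_right
        has_vector_derivative_mult has_vector_derivative_cnj y_deriv[of t, unfolded Zt] zd)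
  then show "(Ec has_vector_derivative 0) (at t)"
    by (rule has_vector_derivative_eq_rhs)
      (use Y(1) in \<open>simp add: NM z' defs(4)[symmetric] field_simps\<close>)
qed

end

section \<open>Keeping the pole away from the circle\<close>

context beta_szego_rational
begin

lemma p_bounded_away:
  assumes \<beta>: "\<beta> < 0"
  obtains \<delta> N M where "0 < \<delta>" "\<delta> \<le> 1"
    "\<And>t. (norm (p t))\<^sup>2 \<le> 1 - \<delta>" "\<And>t. (norm (b t))\<^sup>2 \<le> N" "\<And>t. (norm (c t))\<^sup>2 \<le> M"
proof -
  define Y where "Y t = 1 - (norm (p t))\<^sup>2" for t
  have pn: "(norm (p t))\<^sup>2 < 1" for t
    using p_less[of t] by (simp add: abs_square_less_1)
  have Y: "0 < Y t" "Y t \<le> 1" for t using pn[of t] by (auto simp: Y_def)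
  have yY: "y t = of_real (Y t)" for t
    by (simp add: y_def Y_def complex_norm_square[symmetric])
  define M where "M = (norm (c 0))\<^sup>2 / (Y 0)\<^sup>2"
  define N where "N = (norm (b 0))\<^sup>2 + M * Y 0"
  have M0: "M > 0" using c_nonzero[of 0] Y[of 0] by (simp add: M_def)
  have Mc_real: "Mc t = of_real ((norm (c t))\<^sup>2 / (Y t)\<^sup>2)" for t
    unfolding Mc_def yY complex_norm_square[symmetric] by (simp add: power2_eq_square)
  have Nc_real: "Nc t = of_real ((norm (b t))\<^sup>2 + (norm (c t))\<^sup>2 / Y t)" for t
    unfolding Nc_def yY complex_norm_square[symmetric] by simp
  have "(norm (c t))\<^sup>2 / (Y t)\<^sup>2 = M" for t
    using Mc_const[of t] unfolding Mc_real M_def of_real_eq_iff .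
  then have cM: "(norm (c t))\<^sup>2 = M * (Y t)\<^sup>2" for t
    using Y(1)[of t] by (metis less_irrefl nonzero_divide_eq_eq power_not_zero)
  have cY: "(norm (c t))\<^sup>2 / Y t = M * Y t" for t
    unfolding cM using Y(1)[of t] by (simp add: power2_eq_square)
  have bN: "(norm (b t))\<^sup>2 = N - M * Y t" for t
    using Nc_const[of t] unfolding Nc_real of_real_eq_iff cY N_def by simp
  define R where "R t = Re (z t)" for t
  define E where "E t = 2 * N * Y t - 3 * M * (Y t)\<^sup>2 + (1 - \<beta>) * M * (2 * Y t - (Y t)\<^sup>2) + 4 * R t" for t
  have NM: "Nc 0 = of_real N" "Mc 0 = of_real M"
    by (simp_all add: Nc_real Mc_real N_def cY) (simp add: M_def)
  have "Ec t = of_real (E t)" for t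
    unfolding Ec_def NM yY complex_add_cnj by (simp add: E_def R_def power2_eq_square)
  then have E: "E t = E 0" for t
    using Ec_const[of t] by (metis of_real_eq_iff)
  \<comment> \<open>AM-GM, using \<open>norm (c t) = sqrt M * Y t\<close>\<close>
  have R: "4 * \<bar>R t\<bar> \<le> 2 * Y t * (N - M * Y t + M)" for t
  proof -
    have c: "norm (c t) = sqrt M * Y t"
      using cM[of t] Y[of t] M0 by (metis abs_of_pos norm_ge_zero real_sqrt_abs real_sqrt_mult real_sqrt_unique)
    have "\<bar>R t\<bar> \<le> norm (b t) * norm (c t) * norm (p t)"
      unfolding R_def using abs_Re_le_cmod[of "z t"] by (simp add: z_def norm_mult)
    also have "\<dots> \<le> norm (b t) * norm (c t) * 1"
      using p_less[of t] by (intro mult_left_mono) auto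
    finally have "4 * \<bar>R t\<bar> \<le> 2 * Y t * (2 * norm (b t) * sqrt M)"
      by (simp add: c mult_ac)
    also have "\<dots> \<le> 2 * Y t * ((norm (b t))\<^sup>2 + (sqrt M)\<^sup>2)"
      using Y[of t] sum_squares_bound[of "norm (b t)" "sqrt M"] by (intro mult_left_mono) auto
    finally show ?thesis using M0 by (simp add: bN)
  qed
  have N: "N \<ge> 0" using bN[of 0] M0 Y[of 0] by (simp add: N_def)
  \<comment> \<open>\<open>K\<close> collects the upper bounds of the terms of \<open>E / Y\<close>:
    \<open>2 * N\<close> and \<open>2 * (1 - \<beta>) * M\<close> directly, and
    \<open>2 * (N + M)\<close> from the estimate of \<open>R\<close>.\<close>
  define K where "K = 2 * N + 2 * (1 - \<beta>) * M + 2 * (N + M)"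
  have K: "K > 0"
    unfolding K_def using N M0 \<beta> by (intro add_nonneg_pos) auto
  have upper: "E 0 \<le> K * Y t" for t
  proof -
    have "E t = 2 * N * Y t - 3 * M * (Y t)\<^sup>2 + 2 * (1 - \<beta>) * M * Y t - (1 - \<beta>) * M * (Y t)\<^sup>2 + 4 * R t"
      by (simp add: E_def algebra_simps)
    moreover have "3 * M * (Y t)\<^sup>2 \<ge> 0" "(1 - \<beta>) * M * (Y t)\<^sup>2 \<ge> 0" "Y t * (M * Y t) \<ge> 0"
      using M0 \<beta> Y[of t] by auto
    ultimately have "E t \<le> 2 * N * Y t + 2 * (1 - \<beta>) * M * Y t + 2 * Y t * (N + M)"
      using R[of t] by (simp add: algebra_simps)
    then show ?thesis using E[of t] by (simp add: K_def algebra_simps)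
  qed
  have lower: "M * Y t * (- 2 * \<beta> - (2 - \<beta>) * Y t) \<le> E 0" for t
    using R[of t] E[of t] by (simp add: E_def algebra_simps power2_eq_square)
  define \<delta> where "\<delta> = (if E 0 > 0 then E 0 / K else - 2 * \<beta> / (2 - \<beta>))"
  have \<delta>0: "\<delta> > 0" using K \<beta> by (auto simp: \<delta>_def divide_simps)
  have \<delta>Y: "\<delta> \<le> Y t" for t
  proof (cases "E 0 > 0")
    case True
    then show ?thesis using upper[of t] K by (simp add: \<delta>_def field_simps)
  next
    case False
    with lower[of t] have "(M * Y t) * (- 2 * \<beta> - (2 - \<beta>) * Y t) \<le> 0" by simp
    moreover have "M * Y t > 0" using M0 Y by simp
    ultimately have "- 2 * \<beta> - (2 - \<beta>) * Y t \<le> 0"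
      by (meson mult_pos_pos not_le)
    then show ?thesis using False \<beta> by (simp add: \<delta>_def field_simps)
  qed
  show ?thesis
  proof (rule that[of \<delta> N M])
    show "\<delta> \<le> 1" using \<delta>Y[of 0] Y(2)[of 0] by simp
    show "(norm (p t))\<^sup>2 \<le> 1 - \<delta>" for t using \<delta>Y[of t] by (simp add: Y_def)
    show "(norm (b t))\<^sup>2 \<le> N" for t using bN[of t] M0 Y(1)[of t] by simp
    show "(norm (c t))\<^sup>2 \<le> M" for t
      unfolding cM using M0 Y[of t] by (intro mult_left_le power_le_one) auto
  qed (rule \<delta>0)
qed

end

section \<open>Persistence of the rational form\<close>

context beta_szego_flow
begin

lemma rational_invariant:
  assumes c0: "c0 \<noteq> 0" and x0: "\<And>n. a 0 (Suc n) = c0 * p0 ^ n"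
  obtains p where "beta_szego_rational \<beta> (\<lambda>t. a t 0) (\<lambda>t. a t 1) p"
    "\<And>t n. a t (Suc n) = a t 1 * p t ^ n"
proof -
  have minors: "a t (Suc (j + l)) * a t (Suc (k + m)) = a t (Suc (j + m)) * a t (Suc (k + l))" for t j k l m
    by (rule hankel_minors_zero[of 0]) (simp add: x0 power_add mult_ac)
  \<comment> \<open>A symmetric minor reads \<open>a_(n+1)^2 = a_1 * a_(2n+1)\<close>. If
    \<open>a_1\<close> vanished at time \<open>t\<close>, so would the whole Hankel matrix, and then
    also at time 0.\<close>
  have c: "a t 1 \<noteq> 0" for t
  proof
    assume "a t 1 = 0"
    then have "a t (Suc n) = 0" for n
      using minors[of t 0 n n 0] by simp
    from nonconstant_coeffs_zero[OF this, of 0 0] show False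
      using c0 x0[of 0] by simp
  qed
  define p where "p t = a t 2 / a t 1" for t
  have geo: "a t (Suc n) = a t 1 * p t ^ n" for t n
  proof (induction n)
    case (Suc n)
    have "a t (Suc (Suc n)) * a t 1 = a t (Suc n) * a t 2"
      using minors[of t n 1 0 0] by (simp add: numeral_2_eq_2)
    then have "a t (Suc (Suc n)) = a t (Suc n) * p t"
      using c[of t] by (simp add: p_def field_simps)
    with Suc show ?case by simp
  qed simp
  \<comment> \<open>The geometric sequence is summable with a nonzero first term, which forces its
    ratio inside the disk.\<close>
  have pl: "norm (p t) < 1" for t
  proof -
    have "summable (\<lambda>n. norm (a t (Suc n)))"
      using summable_coeffs[of t] summable_Suc_iff[of "\<lambda>n. norm (a t n)"] by simp
    then have "summable (\<lambda>n. norm (a t 1) * norm (p t) ^ n)"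
      by (subst (asm) geo) (simp add: norm_mult norm_power)
    then have "summable (\<lambda>n. norm (p t) ^ n)"
      using c[of t] by (subst (asm) summable_cmult_iff) auto
    then show ?thesis by (simp add: summable_geometric_iff)
  qed
  note F = beta_szego_field_rational[of "p t" "a t" "a t 1" \<beta> for t, OF pl geo]
  show ?thesis
  proof (rule that[of p])
    show "beta_szego_rational \<beta> (\<lambda>t. a t 0) (\<lambda>t. a t 1) p"
    proof
      fix t
      let ?y = "1 - p t * cnj (p t)"
      have y: "?y \<noteq> 0" using one_minus_p_cnj_p(2)[OF pl] .
      show "norm (p t) < 1" "a t 1 \<noteq> 0" by (fact pl c)+
      show "((\<lambda>t. a t 0) has_vector_derivative - \<i> * (cnj (a t 0) * (a t 0)\<^sup>2 + 2 * a t 0 * a t 1 * cnj (a t 1) / ?y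
          + cnj (a t 1) * (a t 1)\<^sup>2 * cnj (p t) / ?y\<^sup>2)) (at t)"
        using deriv_coeffs[of 0 t] unfolding F(1) .
      show "((\<lambda>t. a t 1) has_vector_derivative - \<i> * (2 * a t 0 * cnj (a t 0) * a t 1 + 2 * a t 0 * a t 1 * cnj (a t 1) * p t / ?y
          + (1 - of_real \<beta>) * cnj (a t 1) * (a t 1)\<^sup>2 / ?y\<^sup>2)) (at t)"
        using deriv_coeffs[of 1 t] unfolding F(2) .
      have a2: "a t 2 = a t 1 * p t" using geo[of t 1] by (simp add: numeral_2_eq_2)
      have "(p has_vector_derivative (- \<i> * beta_szego_field \<beta> (a t) 2 * a t 1 - a t 2 * (- \<i> * beta_szego_field \<beta> (a t) 1)) / (a t 1)\<^sup>2) (at t)"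
        unfolding p_def[abs_def] by (intro has_vector_derivative_quotient deriv_coeffs c)
      then show "(p has_vector_derivative - \<i> * (cnj (a t 0) * a t 1 + (1 - of_real \<beta>) * a t 1 * cnj (a t 1) * p t / ?y)) (at t)"
      proof (rule has_vector_derivative_eq_rhs)
        define y where "y = ?y"
        have "y \<noteq> 0" using \<open>?y \<noteq> 0\<close> by (simp add: y_def)
        then show "(- \<i> * beta_szego_field \<beta> (a t) 2 * a t 1 - a t 2 * (- \<i> * beta_szego_field \<beta> (a t) 1)) / (a t 1)\<^sup>2 =
            - \<i> * (cnj (a t 0) * a t 1 + (1 - of_real \<beta>) * a t 1 * cnj (a t 1) * p t / ?y)"
          unfolding F a2 y_def[symmetric] using c[of t] by (simp add: field_simps power2_eq_square)
      qed
    qed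
  qed (rule geo)
qed

end

text \<open>Division gives \<open>b + c z / (1 - p z)\<close> with pole \<open>1 / p\<close>; a
  polynomial is the case \<open>p = 0\<close>.\<close>

lemma rational_L1_power_series:
  assumes "f \<in> rational_L1"
  obtains c p b where "c \<noteq> 0" "norm p < 1"
    "\<forall>z. norm z \<le> 1 \<longrightarrow> f z = power_series (case_nat b (\<lambda>n. c * p ^ n)) z"
proof -
  obtain A B where f: "f = (\<lambda>z. poly A z / poly B z)" and deg: "degree A \<le> 1" "degree B \<le> 1"
    and cop: "coprime A B" and nc: "degree A = 1 \<or> degree B = 1"
    and nz: "\<And>z. cmod z \<le> 1 \<Longrightarrow> poly B z \<noteq> 0"
    using assms by (auto simp: rational_L1_def)
  define A0 A1 B0 B1 where "A0 = coeff A 0" "A1 = coeff A 1" "B0 = coeff B 0" "B1 = coeff B 1"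
  note defs = this
  have lin: "q = [:coeff q 0, coeff q 1:]" if "degree q \<le> 1" for q :: "complex poly"
    using that by (intro poly_eqI) (auto simp: coeff_pCons coeff_eq_0 split: nat.split)
  have AB: "A = [:A0, A1:]" "B = [:B0, B1:]"
    using lin[OF deg(1)] lin[OF deg(2)] by (simp_all add: defs)
  have B0: "B0 \<noteq> 0" using nz[of 0] by (simp add: AB)
  define p where "p = - B1 / B0"
  define b where "b = A0 / B0"
  define c where "c = (A1 + p * A0) / B0"
  have p: "norm p < 1"
  proof (rule ccontr)
    assume "\<not> norm p < 1"
    then have "norm (1 / p) \<le> 1" "p \<noteq> 0" by (auto simp: norm_divide divide_simps)
    moreover have "poly B (1 / p) = 0"
      using B0 \<open>p \<noteq> 0\<close> by (auto simp: AB p_def field_simps)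
    ultimately show False using nz by blast
  qed
  \<comment> \<open>\<open>c = 0\<close> means that \<open>A\<close> and \<open>B\<close> are
    proportional; by coprimality both would then be constant, against the degree condition.\<close>
  have c: "c \<noteq> 0"
  proof
    assume "c = 0"
    then have eq: "A1 * B0 = A0 * B1" using B0 by (simp add: c_def p_def field_simps)
    then have "smult B0 A = smult A0 B" by (simp add: AB mult.commute)
    then have "B dvd smult B0 A" by (simp add: dvd_smult)
    then have "B dvd A" using B0 by (simp add: dvd_smult_iff)
    with cop have "is_unit B" by (metis coprime_absorb_left coprime_commute)
    then have "degree B = 0" using B0 by (subst (asm) is_unit_iff_degree) (auto simp: AB)
    then have "B1 = 0" by (simp add: defs coeff_eq_0)
    with eq B0 have "A1 = 0" by simp
    then have "degree A = 0" by (simp add: AB)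
    with nc \<open>degree B = 0\<close> show False by simp
  qed
  show ?thesis
  proof (rule that[OF c p], intro allI impI)
    fix z :: complex assume z: "norm z \<le> 1"
    have "norm p * norm z \<le> norm p * 1" using z by (intro mult_left_mono) auto
    then have pz: "norm (p * z) < 1" using p by (simp add: norm_mult)
    then have pz1: "1 - p * z \<noteq> 0" by auto
    have "(\<lambda>n. c * z * (p * z) ^ n) sums (c * z * (1 / (1 - p * z)))"
      by (intro sums_mult geometric_sums pz)
    then have "(\<lambda>n. case_nat b (\<lambda>n. c * p ^ n) (Suc n) * z ^ Suc n) sums (c * z / (1 - p * z))"
      by (simp add: power_mult_distrib mult_ac)
    from sums_Suc[OF this] have "power_series (case_nat b (\<lambda>n. c * p ^ n)) z = c * z / (1 - p * z) + b"
      by (simp add: power_series_def sums_iff)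
    also have "\<dots> = f z"
    proof -
      have "poly B z = B0 * (1 - p * z)" using B0 by (simp add: AB p_def field_simps)
      then show ?thesis
        using B0 pz1 by (simp add: f AB b_def c_def field_simps)
    qed
    finally show "f z = power_series (case_nat b (\<lambda>n. c * p ^ n)) z" ..
  qed
qed

section \<open>Uniform Sobolev bounds\<close>

lemma summable_powr_geometric:
  fixes q s :: real
  assumes "0 \<le> q" "q < 1"
  shows "summable (\<lambda>n. (2 + real n) powr s * q ^ n)"
proof (cases "q = 0")
  case True
  then show ?thesis
    by (intro summable_finite[of "{0}"]) auto
next
  case False
  with assms have q: "q > 0" by simp
  \<comment> \<open>The ratio of consecutive terms tends to \<open>q\<close>, hence is eventually
    below the midpoint \<open>(1 + q) / 2\<close> of \<open>q\<close> and 1.\<close>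
  have "(\<lambda>n. ((3 + real n) / (2 + real n)) powr s * q) \<longlonglongrightarrow> 1 powr s * q"
  proof (intro tendsto_intros)
    show "(\<lambda>n. (3 + real n) / (2 + real n)) \<longlonglongrightarrow> 1" by real_asymp
  qed auto
  moreover have "1 powr s * q < (1 + q) / 2" using assms by simp
  ultimately have "eventually (\<lambda>n. ((3 + real n) / (2 + real n)) powr s * q < (1 + q) / 2) sequentially"
    by (rule order_tendstoD)
  then obtain N where N: "\<And>n. n \<ge> N \<Longrightarrow> ((3 + real n) / (2 + real n)) powr s * q < (1 + q) / 2"
    by (auto simp: eventually_sequentially)
  show ?thesis
  proof (rule summable_ratio_test)
    show "(1 + q) / 2 < 1" using assms by simp
    fix n assume "n \<ge> N"
    have "(2 + real (Suc n)) powr s * q ^ Suc n = (((3 + real n) / (2 + real n)) powr s * q) * ((2 + real n) powr s * q ^ n)"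
      by (simp add: powr_divide)
    also have "\<dots> \<le> (1 + q) / 2 * ((2 + real n) powr s * q ^ n)"
      using N[OF \<open>n \<ge> N\<close>] assms by (intro mult_right_mono) auto
    finally show "norm ((2 + real (Suc n)) powr s * q ^ Suc n) \<le> (1 + q) / 2 * norm ((2 + real n) powr s * q ^ n)"
      using assms by simp
  qed
qed

text \<open>\<sigma> fixes the class of solutions, \<open>s\<close> the norm to be bounded.
  Membership in \<open>Hs_plus s\<close> is part of the claim because a bound on
  \<open>Hs_norm\<close> says nothing when its series diverges.\<close>

theorem mainTheorem9:
  fixes \<beta> \<sigma> :: real
    and u0 :: "complex \<Rightarrow> complex"
    and u :: "real \<Rightarrow> complex \<Rightarrow> complex"
  assumes "\<beta> < 0"
    and "u0 \<in> rational_L1"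
    and "\<sigma> > 1/2"
    and "beta_szego_solution \<sigma> \<beta> u"
    and "AE \<theta> in angles. u 0 (cis \<theta>) = u0 (cis \<theta>)"
  shows "\<forall>s\<ge>0. \<exists>C>0. \<forall>t. u t \<in> Hs_plus s \<and> Hs_norm s (u t) \<le> C"
proof (intro allI impI)
  fix s :: real
  define a where "a t n = fourier_coeff (u t) (int n)" for t n
  have L2: "u t \<in> L2_plus" for t
    using assms(4) by (auto simp: beta_szego_solution_def Hs_plus_def)
  interpret beta_szego_flow \<beta> a
    unfolding a_def by unfold_locales (rule beta_szego_solution_coeffs[OF assms(3,4)])+
  obtain c0 p0 b0 where c0: "c0 \<noteq> 0" and p0: "norm p0 < 1"
    and u0: "\<forall>z. norm z \<le> 1 \<longrightarrow> u0 z = power_series (case_nat b0 (\<lambda>n. c0 * p0 ^ n)) z"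
    by (rule rational_L1_power_series[OF assms(2)])
  let ?x = "case_nat b0 (\<lambda>n. c0 * p0 ^ n)"
  have "summable (\<lambda>n. norm (?x (Suc n)))"
    using p0 by (simp add: norm_mult norm_power)
  then have x: "summable (\<lambda>n. norm (?x n))"
    using summable_Suc_iff[of "\<lambda>n. norm (?x n)"] by simp
  \<comment> \<open>The initial datum is prescribed almost everywhere only, which still determines
    its Fourier coefficients.\<close>
  have "a 0 n = ?x n" for n
  proof -
    have "a 0 n = fourier_coeff (power_series ?x) (int n)"
      unfolding a_def
    proof (rule fourier_coeff_cong_AE)
      show "AE \<theta> in angles. u 0 (cis \<theta>) = power_series ?x (cis \<theta>)"
        using assms(5) by eventually_elim (simp add: u0)
      show "(\<lambda>\<theta>. u 0 (cis \<theta>)) \<in> borel_measurable angles"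
        using L2[of 0] by (auto simp: L2_plus_def L2_circle_def)
      show "(\<lambda>\<theta>. power_series ?x (cis \<theta>)) \<in> borel_measurable angles"
        using circle_integrable_power_series[OF x] by (auto simp: circle_integrable_def)
    qed
    then show ?thesis by (simp add: fourier_coeff_power_series[OF x])
  qed
  then have "a 0 (Suc n) = c0 * p0 ^ n" for n by simp
  then obtain p where r: "beta_szego_rational \<beta> (\<lambda>t. a t 0) (\<lambda>t. a t 1) p"
    and geo: "\<And>t n. a t (Suc n) = a t 1 * p t ^ n"
    using rational_invariant[OF c0] by metis
  obtain \<delta> N M where \<delta>: "0 < \<delta>" "\<delta> \<le> 1"
    and bd: "\<And>t. (norm (p t))\<^sup>2 \<le> 1 - \<delta>" "\<And>t. (norm (a t 0))\<^sup>2 \<le> N" "\<And>t. (norm (a t 1))\<^sup>2 \<le> M"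
    using beta_szego_rational.p_bounded_away[OF r assms(1)] by metis
  \<comment> \<open>A majorant independent of time. Mode \<open>Suc n\<close> has weight base
    \<open>1 + real (Suc n) = 2 + real n\<close>.\<close>
  define g where "g = case_nat N (\<lambda>n. M * ((2 + real n) powr (2 * s) * (1 - \<delta>) ^ n))"
  have "summable (\<lambda>n. g (Suc n))"
    using \<delta> by (simp add: g_def summable_mult summable_powr_geometric)
  then have g: "summable g" by (subst (asm) summable_Suc_iff)
  have le: "(1 + real n) powr (2 * s) * (norm (a t n))\<^sup>2 \<le> g n" for t n
  proof (cases n)
    case 0
    then show ?thesis using bd(2)[of t] by (simp add: g_def)
  next
    case (Suc k)
    have "(norm (a t n))\<^sup>2 = (norm (a t 1))\<^sup>2 * ((norm (p t))\<^sup>2) ^ k"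
      unfolding Suc geo[of t k] by (simp add: norm_mult norm_power power_mult_distrib power_mult[symmetric] mult.commute)
    also have "\<dots> \<le> M * (1 - \<delta>) ^ k"
      using bd(3)[of t] by (intro mult_mono bd power_mono) (auto intro: order.trans[OF zero_le_power2])
    finally have "(2 + real k) powr (2 * s) * (norm (a t n))\<^sup>2 \<le> (2 + real k) powr (2 * s) * (M * (1 - \<delta>) ^ k)"
      by (rule mult_left_mono) simp
    then show ?thesis by (simp add: g_def Suc mult_ac)
  qed
  have sm: "summable (\<lambda>n. (1 + real n) powr (2 * s) * (norm (a t n))\<^sup>2)" for t
    by (rule summable_comparison_test[OF _ g]) (use le in auto)
  show "\<exists>C>0. \<forall>t. u t \<in> Hs_plus s \<and> Hs_norm s (u t) \<le> C"
  proof (intro exI conjI allI)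
    fix t
    show "u t \<in> Hs_plus s"
      using L2 sm by (simp add: Hs_plus_def a_def)
    have "Hs_norm s (u t) \<le> sqrt (\<Sum>n. g n)"
      unfolding Hs_norm_def a_def[symmetric] by (intro real_sqrt_le_mono suminf_le le sm g)
    then show "Hs_norm s (u t) \<le> \<bar>sqrt (\<Sum>n. g n)\<bar> + 1" by simp
  qed simp
qed

end
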